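(* The projection $p_S:\widetilde{\mathrm{Sp}}_{\psi,S}^R(W)\to\mathrm{Sp}(W)$ endows the metaplectic group with the structure of a topological covering with base $\mathrm{Sp}(W)$ and (discrete) fibre $R^\times$. Moreover, there exist global (continuous) sections of $p_S$.
   Context: $F$ is a field which is either finite of characteristic $p$ or non-archimedean local of residual characteristic $p$, of characteristic different from $2$; $(W,\langle\,,\rangle)$ is a finite-dimensional symplectic space over $F$; $R$ is a field with a fixed non-trivial smooth character $\psi:F\to R^\times$ (so $\mathrm{char}\,R\neq p$). Heisenberg group: $H=W\times F$ with $(w,t)(w',t')=(w+w',t+t'+\tfrac12\langle w,w'\rangle)$, centre $F=\{(0,t)\}$. $(\rho_\psi,S)$ is a model of the unique (up to isomorphism) irreducible smooth $R$-representation of $H$ with central character $\psi$. $\widetilde{\mathrm{Sp}}_{\psi,S}^R(W)=\{(g,M)\in\mathrm{Sp}(W)\times\mathrm{GL}_R(S): M\rho_\psi(w,t)M^{-1}=\rho_\psi(g^{-1}w,t)\ \forall(w,t)\in H\}$, with $p_S(g,M)=g$; it is a central extension of $\mathrm{Sp}(W)$ by $R^\times$ (embedded by $\lambda\mapsto(\mathrm{Id}_W,\lambda\,\mathrm{Id}_S)$). It carries the subspace topology from $\mathrm{Sp}(W)\times\mathrm{GL}_R(S)$, where $R$ and $S$ are discrete and $\mathrm{GL}_R(S)$ has the compact-open topology, generated by the sets $\{g:gs=s'\}$, $s,s'\in S$. *)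

theory Defs
  imports "HOL-Analysis.Analysis"
begin

section \<open>The base field\<close>

text \<open>
  A non-archimedean local field is a field that is complete for a (non-trivial) discrete
  non-archimedean absolute value \<open>v\<close>, with finite residue field \<open>{v \<le> 1} / {v < 1}\<close>.  The last
  assumption says that the prime \<open>p\<close> vanishes in the residue field.
\<close>
locale nonarch_local_field =
  fixes v :: "'f::field \<Rightarrow> real" and p :: nat
  assumes v_nonneg: "0 \<le> v x"
    and v_eq_0_iff: "v x = 0 \<longleftrightarrow> x = 0"
    and v_mult: "v (x * y) = v x * v y"
    and v_add_le_max: "v (x + y) \<le> max (v x) (v y)"
    and discrete_valuation:
      "\<exists>\<pi>. 0 < v \<pi> \<and> v \<pi> < 1 \<and> (\<forall>x. x \<noteq> 0 \<longrightarrow> (\<exists>n::int. v x = v \<pi> powi n))"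
    and complete: "Metric_space.mcomplete UNIV (\<lambda>x y. v (x - y))"
    and finite_residue_field:
      "finite ({x. v x \<le> 1} // {(x, y). v x \<le> 1 \<and> v y \<le> 1 \<and> v (x - y) < 1})"
    and residue_char: "prime p" "v (of_nat p) < 1"

text \<open>
  The absolute value is not part of the data, only the topology of the field is.
\<close>
definition finite_or_local_field :: "nat \<Rightarrow> 'f::field topology \<Rightarrow> bool" where
  "finite_or_local_field p TF \<longleftrightarrow>
     (finite (UNIV :: 'f set) \<and> CHAR('f) = p \<and> TF = discrete_topology UNIV) \<or>
     (\<exists>v :: 'f \<Rightarrow> real. nonarch_local_field v p \<and>
        TF = Metric_space.mtopology UNIV (\<lambda>x y. v (x - y)))"

definition smooth_character :: "'f::field topology \<Rightarrow> ('f \<Rightarrow> 'r::field) \<Rightarrow> bool" where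
  "smooth_character TF \<psi> \<longleftrightarrow>
     (\<forall>x. \<psi> x \<noteq> 0) \<and> (\<forall>x y. \<psi> (x + y) = \<psi> x * \<psi> y) \<and> openin TF {x. \<psi> x = 1}"

section \<open>Symplectic spaces and Heisenberg groups\<close>

locale symplectic_space = finite_dimensional_vector_space scale Basis
  for scale :: "'f::field \<Rightarrow> 'w::ab_group_add \<Rightarrow> 'w" and Basis :: "'w set" +
  fixes form :: "'w \<Rightarrow> 'w \<Rightarrow> 'f"
  assumes form_linear_left: "Vector_Spaces.linear scale (*) (\<lambda>w. form w w')"
    and form_linear_right: "Vector_Spaces.linear scale (*) (\<lambda>w'. form w w')"
    and form_alternating: "form w w = 0"
    and form_nondegenerate: "(\<And>w'. form w w' = 0) \<Longrightarrow> w = 0"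
begin

definition Sp :: "('w \<Rightarrow> 'w) set" where
  "Sp = {g. Vector_Spaces.linear scale scale g \<and> bij g \<and>
            (\<forall>w w'. form (g w) (g w') = form w w')}"

text \<open>
  The topologies of the vector space and of its symplectic group are those given by coordinates
  and by matrix entries; they do not depend on the basis.
\<close>
definition W_topology :: "'f topology \<Rightarrow> 'w topology" where
  "W_topology TF = pullback_topology UNIV (\<lambda>w. \<lambda>b\<in>Basis. representation Basis w b)
     (product_topology (\<lambda>_. TF) Basis)"

definition Sp_topology :: "'f topology \<Rightarrow> ('w \<Rightarrow> 'w) topology" where
  "Sp_topology TF = pullback_topology Sp
     (\<lambda>g. \<lambda>(b, b')\<in>Basis \<times> Basis. representation Basis (g b') b)
     (product_topology (\<lambda>_. TF) (Basis \<times> Basis))"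

definition heis_mult :: "'w \<times> 'f \<Rightarrow> 'w \<times> 'f \<Rightarrow> 'w \<times> 'f" where
  "heis_mult = (\<lambda>(w, t) (w', t'). (w + w', t + t' + form w w' / 2))"

definition heis_topology :: "'f topology \<Rightarrow> ('w \<times> 'f) topology" where
  "heis_topology TF = prod_topology (W_topology TF) TF"

lemma heis_mult_assoc: "heis_mult (heis_mult x y) z = heis_mult x (heis_mult y z)"
proof -
  have l: "form (a + b) c = form a c + form b c" for a b c
    using form_linear_left[of c] by (simp add: Vector_Spaces.linear_iff)
  have r: "form a (b + c) = form a b + form a c" for a b c
    using form_linear_right[of a] by (simp add: Vector_Spaces.linear_iff)
  show ?thesis
    by (simp add: heis_mult_def l r add_divide_distrib ac_simps split: prod.splits)
qed

end

section \<open>Smooth representations of the Heisenberg group\<close>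

definition GL :: "('r::field \<Rightarrow> 's::ab_group_add \<Rightarrow> 's) \<Rightarrow> ('s \<Rightarrow> 's) set" where
  "GL scl = {M. Vector_Spaces.linear scl scl M \<and> bij M}"

text \<open>The compact-open topology for the discrete topology on the vector space.\<close>
definition GL_topology :: "('r::field \<Rightarrow> 's::ab_group_add \<Rightarrow> 's) \<Rightarrow> ('s \<Rightarrow> 's) topology" where
  "GL_topology scl = topology_generated_by {{M \<in> GL scl. M s = s'} | s s'. True}"

locale heisenberg_representation =
  W: symplectic_space scaleW Basis form + S: vector_space scaleS
  for scaleW :: "'f::field \<Rightarrow> 'w::ab_group_add \<Rightarrow> 'w" and Basis form
    and scaleS :: "'r::field \<Rightarrow> 's::ab_group_add \<Rightarrow> 's" +
  fixes TF :: "'f topology" and \<psi> :: "'f \<Rightarrow> 'r" and \<rho> :: "'w \<times> 'f \<Rightarrow> 's \<Rightarrow> 's"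
  assumes rep_GL: "\<rho> h \<in> GL scaleS"
    and rep_mult: "\<rho> (W.heis_mult h h') = \<rho> h \<circ> \<rho> h'"
    and smooth: "openin (W.heis_topology TF) {h. \<rho> h s = s}"
    and nonzero: "\<exists>s::'s. s \<noteq> 0"
    and irreducible: "\<lbrakk>S.subspace U; \<And>h. \<rho> h ` U \<subseteq> U\<rbrakk> \<Longrightarrow> U = {0} \<or> U = UNIV"
    and central_character: "\<rho> (0, t) s = scaleS (\<psi> t) s"

locale metaplectic_setting =
  heisenberg_representation scaleW Basis form scaleS TF \<psi> \<rho>
  for p :: nat and TF :: "'f::field topology"
    and scaleW :: "'f \<Rightarrow> 'w::ab_group_add \<Rightarrow> 'w" and Basis form
    and \<psi> :: "'f \<Rightarrow> 'r::field"
    and scaleS :: "'r \<Rightarrow> 's::ab_group_add \<Rightarrow> 's" and \<rho> +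
  assumes base_field: "finite_or_local_field p TF"
    and char_ne_2: "CHAR('f) \<noteq> 2"
    and \<psi>_smooth: "smooth_character TF \<psi>"
    and \<psi>_nontrivial: "\<exists>t. \<psi> t \<noteq> 1"

section \<open>The metaplectic group\<close>

context heisenberg_representation
begin

text \<open>
  With \<open>g\<inverse>\<close> on the right-hand side and \<open>Sp\<close> acting on the left, \<open>Mp\<close> is a group for the
  composition of the second components and the reversed composition of the first ones.  Only the
  underlying topological space is used below.
\<close>
definition Mp :: "(('w \<Rightarrow> 'w) \<times> ('s \<Rightarrow> 's)) set" where
  "Mp = {(g, M). g \<in> W.Sp \<and> M \<in> GL scaleS \<and>
                 (\<forall>w t. M \<circ> \<rho> (w, t) \<circ> inv M = \<rho> (inv g w, t))}"

definition Mp_topology :: "(('w \<Rightarrow> 'w) \<times> ('s \<Rightarrow> 's)) topology" where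
  "Mp_topology = subtopology (prod_topology (W.Sp_topology TF) (GL_topology scaleS)) Mp"

end

section \<open>Coverings with a prescribed fibre\<close>

text \<open>
  Local triviality over the base \<open>B\<close>, with the fibre \<open>D\<close> carrying the discrete topology.
\<close>
definition covering_with_fibre ::
    "'x topology \<Rightarrow> 'b topology \<Rightarrow> 'd set \<Rightarrow> ('x \<Rightarrow> 'b) \<Rightarrow> bool" where
  "covering_with_fibre X B D \<pi> \<longleftrightarrow>
     continuous_map X B \<pi> \<and>
     (\<forall>b \<in> topspace B. \<exists>U \<phi>. openin B U \<and> b \<in> U \<and>
        homeomorphic_map (subtopology X {x \<in> topspace X. \<pi> x \<in> U})
          (prod_topology (subtopology B U) (discrete_topology D)) \<phi> \<and>
        (\<forall>x \<in> topspace X. \<pi> x \<in> U \<longrightarrow> fst (\<phi> x) = \<pi> x))"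

section \<open>Underlying sets of the topologies\<close>

lemma topspace_finite_or_local_field:
  fixes TF :: "'f::field topology"
  assumes "finite_or_local_field p TF"
  shows "topspace TF = UNIV"
  using assms unfolding finite_or_local_field_def
proof (elim disjE exE conjE)
  fix v :: "'f \<Rightarrow> real"
  assume "nonarch_local_field v p" and TF: "TF = Metric_space.mtopology UNIV (\<lambda>x y. v (x - y))"
  then interpret nonarch_local_field v p by simp
  have one: "v 1 = 1"
    using v_mult[of 1 1] v_eq_0_iff[of 1] by simp
  have "v (-1) * v (-1) = 1"
    using v_mult[of "-1" "-1"] one by simp
  then have "v (-1) = 1"
    using v_nonneg[of "-1"] by (simp add: square_eq_1_iff)
  then have neg: "v (- x) = v x" for x
    using v_mult[of "-1" x] by simp
  have "Metric_space (UNIV :: 'f set) (\<lambda>x y. v (x - y))"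
  proof
    show "v (x - y) = v (y - x)" for x y
      using neg[of "x - y"] by simp
    show "v (x - z) \<le> v (x - y) + v (y - z)" for x y z
      using v_add_le_max[of "x - y" "y - z"] v_nonneg[of "x - y"] v_nonneg[of "y - z"] by simp
  qed (simp_all add: v_nonneg v_eq_0_iff)
  then show ?thesis
    by (simp add: TF Metric_space.topspace_mtopology)
qed simp

lemma topspace_GL_topology: "topspace (GL_topology scl) = GL scl"
  by (auto simp: GL_topology_def)

context metaplectic_setting
begin

lemma topspace_W_topology: "topspace (W.W_topology TF) = UNIV"
  using topspace_finite_or_local_field[OF base_field]
  by (auto simp: W.W_topology_def topspace_pullback_topology)

lemma topspace_Sp_topology: "topspace (W.Sp_topology TF) = W.Sp"
  using topspace_finite_or_local_field[OF base_field]
  by (auto simp: W.Sp_topology_def topspace_pullback_topology)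

lemma topspace_Mp_topology: "topspace Mp_topology = Mp"
  by (auto simp: Mp_topology_def Mp_def topspace_Sp_topology topspace_GL_topology)

end

end

theory Submission
  imports Defs
begin

text \<open>
  Let \<open>W\<close> have a symplectic basis and let \<open>L\<close> be the set of vectors with one half of the coordinates
  in \<open>A\<close> and the other half in \<open>D\<close>, where \<open>A\<close> and \<open>D\<close> are subgroups of \<open>F\<close> that are each other's
  orthogonal for \<open>\<psi>(x y)\<close>.  Then \<open>L\<close> is its own orthogonal for \<open>\<psi> \<circ> form\<close>.  For a
  suitable \<open>\<theta>\<close> on \<open>L\<close>, an irreducible representation contains a vector \<open>u\<close> on which \<open>L\<close> acts through
  \<open>\<theta>\<close>.  The translates of \<open>u\<close> by representatives of \<open>W / L\<close> are eigenvectors of \<open>L\<close> with distinct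
  characters, hence a basis on which the Heisenberg group acts by explicit formulas.  This gives the
  uniqueness of the representation (a unique intertwiner for every choice of such vectors) and
  Schur's lemma.

  For \<open>g\<close> in \<open>Sp\<close> choose a vector \<open>u\<^sub>g\<close> on which \<open>\<rho>(g l, 0)\<close> is \<open>\<theta>(l)\<close> for \<open>l\<close> in \<open>L\<close>.  The condition, and so
  \<open>u\<^sub>g\<close>, is locally constant in \<open>g\<close>.  Let \<open>M\<^sub>g\<close> be the intertwiner with \<open>M\<^sub>g u\<^sub>g = u\<^sub>1\<close>.  Then
  \<open>M\<^sub>g (\<rho>(w, t) u\<^sub>g) = \<rho>(g\<inverse> w, t) u\<^sub>1\<close> is locally constant in \<open>g\<close> by smoothness, so \<open>g \<mapsto> (g, M\<^sub>g)\<close> is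
  a continuous section, and \<open>(g, c) \<mapsto> (g, c M\<^sub>g)\<close> trivialises the covering globally.
\<close>

section \<open>The base field\<close>

definition add_subgroup :: "'a::ab_group_add set \<Rightarrow> bool" where
  "add_subgroup N \<longleftrightarrow> 0 \<in> N \<and> (\<forall>x\<in>N. \<forall>y\<in>N. x - y \<in> N)"

lemma add_subgroupD:
  assumes "add_subgroup N"
  shows "0 \<in> N" "x \<in> N \<Longrightarrow> - x \<in> N" "x \<in> N \<Longrightarrow> y \<in> N \<Longrightarrow> x + y \<in> N"
    "x \<in> N \<Longrightarrow> y \<in> N \<Longrightarrow> x - y \<in> N"
proof -
  show 0: "0 \<in> N"
    using assms by (simp add: add_subgroup_def)
  show d: "x - y \<in> N" if "x \<in> N" "y \<in> N" for x y
    using assms that by (simp add: add_subgroup_def)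
  show m: "- x \<in> N" if "x \<in> N" for x
    using d[OF 0 that] by simp
  show "x + y \<in> N" if "x \<in> N" "y \<in> N" for x y
    using d[OF that(1) m[OF that(2)]] by simp
qed

lemma add_subgroup_sum:
  assumes "add_subgroup N" "\<And>i. i \<in> I \<Longrightarrow> h i \<in> N"
  shows "sum h I \<in> N"
  using assms(2) by (induction I rule: infinite_finite_induct) (auto simp: add_subgroupD[OF assms(1)])

text \<open>All that is needed of the base field.  In the local case \<open>A\<close> is the ring of integers and \<open>D\<close> its
  dual with respect to \<open>\<psi>\<close>; for a finite field \<open>A = UNIV\<close> and \<open>D = {0}\<close>.\<close>
locale dual_lattices =
  fixes TF :: "'f::field topology" and \<psi> :: "'f \<Rightarrow> 'r::field" and p :: nat and A D :: "'f set"
  assumes psi_add: "\<psi> (x + y) = \<psi> x * \<psi> y"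
    and psi_nonzero: "\<psi> x \<noteq> 0"
    and psi_open: "openin TF {x. \<psi> x = 1}"
    and two_nonzero: "(2::'f) \<noteq> 0"
    and prime_p: "prime p"
    and p_nonzero: "(of_nat p :: 'r) \<noteq> 0"
    and affine_open: "openin TF U \<Longrightarrow> openin TF {x. a * x + b \<in> U}"
    and small_subgroup: "openin TF U \<Longrightarrow> 0 \<in> U \<Longrightarrow> \<exists>B. openin TF B \<and> add_subgroup B \<and> B \<subseteq> U"
    and A_perp: "x \<in> A \<longleftrightarrow> (\<forall>y\<in>D. \<psi> (x * y) = 1)"
    and D_perp: "y \<in> D \<longleftrightarrow> (\<forall>x\<in>A. \<psi> (x * y) = 1)"
    and small_products: "\<exists>B. openin TF B \<and> 0 \<in> B \<and> (\<forall>x\<in>insert 1 (A \<union> D). \<forall>b\<in>B. x * b / 2 \<in> A \<inter> D)"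
    and sublattice: "C \<in> {A, D} \<Longrightarrow> openin TF B \<Longrightarrow> 0 \<in> B \<Longrightarrow>
      \<exists>C' k X. C' \<subseteq> C \<inter> B \<and> add_subgroup C' \<and>
        (\<forall>x. (\<forall>y. (\<forall>c\<in>C'. \<psi> (c * y) = 1) \<longrightarrow> \<psi> (x * y) = 1) \<longrightarrow> x \<in> C') \<and>
        (\<forall>x\<in>C. of_nat (p ^ k) * x \<in> C') \<and>
        finite X \<and> (\<forall>x\<in>C. \<exists>a\<in>X. x - a \<in> C')"

lemma add_subgroup_of_nat_mult:
  fixes x :: "'a::ring_1"
  shows "add_subgroup N \<Longrightarrow> x \<in> N \<Longrightarrow> of_nat k * x \<in> N"
  by (induction k) (simp_all add: add_subgroupD algebra_simps)

lemma add_subgroup_Int: "add_subgroup M \<Longrightarrow> add_subgroup N \<Longrightarrow> add_subgroup (M \<inter> N)"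
  by (simp add: add_subgroup_def)

lemma character_simps:
  fixes \<psi> :: "'f::field \<Rightarrow> 'r::field"
  assumes nz: "\<And>x. \<psi> x \<noteq> 0" and add: "\<And>x y. \<psi> (x + y) = \<psi> x * \<psi> y"
  shows "\<psi> 0 = 1" "\<psi> (- x) = inverse (\<psi> x)" "\<psi> (x - y) = \<psi> x / \<psi> y" "\<psi> (of_nat n * x) = \<psi> x ^ n"
    "\<psi> (sum h I) = (\<Prod>i\<in>I. \<psi> (h i))"
proof -
  show zero: "\<psi> 0 = 1"
    using add[of 0 0] nz[of 0] by simp
  show minus: "\<psi> (- x) = inverse (\<psi> x)" for x
    using add[of x "- x"] zero nz[of x] by (simp add: field_simps)
  show "\<psi> (x - y) = \<psi> x / \<psi> y"
    using add[of x "- y"] minus[of y] by (simp add: divide_inverse)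
  show "\<psi> (of_nat n * x) = \<psi> x ^ n"
    by (induction n) (auto simp: zero add algebra_simps)
  show "\<psi> (sum h I) = (\<Prod>i\<in>I. \<psi> (h i))"
    by (induction I rule: infinite_finite_induct) (auto simp: zero add)
qed

lemma smooth_characterD:
  fixes \<psi> :: "'f::field \<Rightarrow> 'r::field"
  assumes "smooth_character TF \<psi>"
  shows "\<psi> x \<noteq> 0" "\<psi> (x + y) = \<psi> x * \<psi> y" "openin TF {x. \<psi> x = 1}" "\<psi> 0 = 1"
    "\<psi> (of_nat n * x) = \<psi> x ^ n"
proof -
  show nz: "\<psi> x \<noteq> 0" and add: "\<psi> (x + y) = \<psi> x * \<psi> y" for x y
    using assms by (auto simp: smooth_character_def)
  show "openin TF {x. \<psi> x = 1}"
    using assms by (auto simp: smooth_character_def)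
  show "\<psi> 0 = 1" "\<psi> (of_nat n * x) = \<psi> x ^ n"
    by (rule character_simps[OF nz add])+
qed

text \<open>In characteristic p the map \<open>x \<mapsto> x ^ (p ^ k)\<close> is additive, so
  \<open>(a - 1) ^ (p ^ k)\<close> vanishes. This excludes characteristic p for the coefficient
  field: \<psi> has values of p-power order and would be trivial.\<close>

lemma power_prime_eq_1_imp_eq_1:
  fixes a :: "'r::field"
  assumes "prime p" "(of_nat p :: 'r) = 0" "a ^ (p ^ k) = 1"
  shows "a = 1"
proof -
  have "CHAR('r) dvd p"
    using assms(2) by (simp add: of_nat_eq_0_iff_char_dvd)
  moreover have "CHAR('r) \<noteq> 1"
    using CHAR_not_1' by simp
  ultimately have c: "CHAR('r) = p"
    using assms(1) by (auto simp: prime_nat_iff)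
  have "prime CHAR('r)"
    using assms(1) c by simp
  then have "(a - 1 + 1) ^ (p ^ k) = (a - 1) ^ (p ^ k) + 1 ^ (p ^ k)"
    using freshmans_dream'[of "p ^ k" k "a - 1" 1] c by simp
  then have "(a - 1) ^ (p ^ k) = 0"
    using assms(3) by simp
  then show ?thesis
    by simp
qed

context dual_lattices
begin

text \<open>The orthogonal of any set for \<open>\<psi> (x * y)\<close> is a subgroup, and A and D
  are orthogonals of each other.\<close>

lemma A_subgroup: "add_subgroup A" and D_subgroup: "add_subgroup D"
proof -
  note psi = character_simps[of \<psi>, OF psi_nonzero psi_add]
  have "A = {x. \<forall>y\<in>D. \<psi> (x * y) = 1}" using A_perp by blast
  then show "add_subgroup A"
    by (simp only:) (simp add: add_subgroup_def left_diff_distrib psi)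
  have "D = {y. \<forall>x\<in>A. \<psi> (x * y) = 1}" using D_perp by blast
  then show "add_subgroup D"
    by (simp only:) (simp add: add_subgroup_def right_diff_distrib psi)
qed

lemma psi_A_D: "a \<in> A \<Longrightarrow> d \<in> D \<Longrightarrow> \<psi> (a * d) = 1"
  using A_perp by blast

text \<open>Absorbs finitely many fixed coefficients, such as matrix entries or coordinates of a
  vector, into one open subgroup.\<close>

lemma small_multiples:
  assumes "openin TF U" "0 \<in> U" "finite C"
  shows "\<exists>B. openin TF B \<and> add_subgroup B \<and> (\<forall>c\<in>C. \<forall>x\<in>B. c * x \<in> U)"
  using assms(3)
proof induction
  case empty
  then show ?case using small_subgroup[OF assms(1,2)] by blast
next
  case (insert c C)
  then obtain B where B: "openin TF B" "add_subgroup B" "\<And>c x. c \<in> C \<Longrightarrow> x \<in> B \<Longrightarrow> c * x \<in> U"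
    by blast
  have "openin TF (B \<inter> {x. c * x + 0 \<in> U})"
    using B(1) affine_open[OF assms(1)] by blast
  moreover have "0 \<in> B \<inter> {x. c * x + 0 \<in> U}"
    using add_subgroupD(1)[OF B(2)] assms(2) by simp
  ultimately obtain B' where "openin TF B'" "add_subgroup B'" "B' \<subseteq> B \<inter> {x. c * x + 0 \<in> U}"
    using small_subgroup by blast
  then show ?case
    using B(3) by (intro exI[of _ B']) auto
qed

end

section \<open>Local fields: balls, the conductor of \<psi> and dual lattices\<close>

context nonarch_local_field
begin

lemma v_zero: "v 0 = 0" and v_one: "v 1 = 1" and v_pos: "x \<noteq> 0 \<Longrightarrow> 0 < v x"
proof -
  show "v 0 = 0" by (simp add: v_eq_0_iff)
  show "v 1 = 1" using v_mult[of 1 1] v_eq_0_iff[of 1] by simp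
  show "x \<noteq> 0 \<Longrightarrow> 0 < v x" using v_nonneg[of x] v_eq_0_iff[of x] by simp
qed

lemma v_minus: "v (- x) = v x"
proof -
  have "v (-1) * v (-1) = 1"
    using v_mult[of "-1" "-1"] v_one by simp
  then have "v (-1) = 1"
    using v_nonneg[of "-1"] by (simp add: square_eq_1_iff)
  then show ?thesis
    using v_mult[of "-1" x] by simp
qed

lemma v_diff_le: "v x \<le> r \<Longrightarrow> v y \<le> r \<Longrightarrow> v (x - y) \<le> r"
  using v_add_le_max[of x "- y"] v_minus[of y] by simp

lemma v_diff_less: "v x < r \<Longrightarrow> v y < r \<Longrightarrow> v (x - y) < r"
  using v_add_le_max[of x "- y"] v_minus[of y] by simp

lemma v_divide: "v (x / y) = v x / v y"
proof (cases "y = 0")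
  case False
  then have "v (x / y) * v y = v x"
    using v_mult[of "x / y" y] by simp
  then show ?thesis
    using v_pos[OF False] by (simp add: field_simps)
qed (simp add: v_zero)

lemma v_power: "v (x ^ n) = v x ^ n"
  by (induction n) (simp_all add: v_one v_mult)

sublocale metric: Metric_space UNIV "\<lambda>x y. v (x - y)"
proof
  show "v (x - y) = v (y - x)" for x y
    using v_minus[of "x - y"] by simp
  show "v (x - z) \<le> v (x - y) + v (y - z)" for x y z
    using v_add_le_max[of "x - y" "y - z"] v_nonneg[of "x - y"] v_nonneg[of "y - z"] by simp
qed (simp_all add: v_nonneg v_eq_0_iff)

lemma open_iff: "openin metric.mtopology U \<longleftrightarrow> (\<forall>x\<in>U. \<exists>r>0. \<forall>y. v (x - y) < r \<longrightarrow> y \<in> U)"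
  by (auto simp: metric.openin_mtopology subset_iff Ball_def)

lemma open_ball: "openin metric.mtopology {x. v x < r}"
  unfolding open_iff
proof
  fix x assume x: "x \<in> {x. v x < r}"
  then have "0 < r" using v_nonneg[of x] by simp
  moreover have "v y < r" if "v (x - y) < r" for y
    using v_diff_less[of x r "x - y"] that x by simp
  ultimately show "\<exists>s>0. \<forall>y. v (x - y) < s \<longrightarrow> y \<in> {x. v x < r}"
    by auto
qed

lemma open_affine:
  assumes "openin metric.mtopology U"
  shows "openin metric.mtopology {x. a * x + b \<in> U}"
  unfolding open_iff
proof
  fix x assume "x \<in> {x. a * x + b \<in> U}"
  then obtain r where r: "r > 0" "\<And>y. v (a * x + b - y) < r \<Longrightarrow> y \<in> U"
    using assms unfolding open_iff by auto
  have "a * y + b \<in> U" if "v (x - y) < r / (v a + 1)" for y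
  proof (rule r(2))
    have "v (a * x + b - (a * y + b)) = v a * v (x - y)"
      using v_mult[of a "x - y"] by (simp add: algebra_simps)
    also have "\<dots> \<le> (v a + 1) * v (x - y)"
      using v_nonneg[of "x - y"] by (simp add: mult_right_mono)
    also have "\<dots> < r"
      using that v_nonneg[of a] by (simp add: field_simps add_nonneg_pos)
    finally show "v (a * x + b - (a * y + b)) < r" .
  qed
  moreover have "r / (v a + 1) > 0"
    using r(1) v_nonneg[of a] by (simp add: add_nonneg_pos)
  ultimately show "\<exists>s>0. \<forall>y. v (x - y) < s \<longrightarrow> y \<in> {x. a * x + b \<in> U}"
    by auto
qed

lemma open_0_ball:
  assumes "openin metric.mtopology U" "0 \<in> U"
  obtains r where "r > 0" "{x. v x < r} \<subseteq> U"
proof -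
  obtain r where "r > 0" "\<And>y. v (0 - y) < r \<Longrightarrow> y \<in> U"
    using assms unfolding open_iff by blast
  then show ?thesis
    by (intro that[of r]) (auto simp: v_minus)
qed

text \<open>Nonzero values are integral powers of \<open>v \<pi>\<close>, so no value lies strictly
  between \<open>v \<pi> * v y\<close> and \<open>v y\<close>. This gap drives the digit expansion
  and the search for the conductor.\<close>

lemma uniformizer:
  obtains \<pi> where "0 < v \<pi>" "v \<pi> < 1" "\<And>x y. v x < v y \<Longrightarrow> v x \<le> v \<pi> * v y"
proof -
  obtain \<pi> where \<pi>: "0 < v \<pi>" "v \<pi> < 1" "\<And>x. x \<noteq> 0 \<Longrightarrow> \<exists>n::int. v x = v \<pi> powi n"
    using discrete_valuation by blast
  show ?thesis
  proof (rule that[OF \<pi>(1,2)])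
    fix x y assume less: "v x < v y"
    show "v x \<le> v \<pi> * v y"
    proof (cases "x = 0")
      case True
      then show ?thesis using \<pi>(1) v_nonneg[of y] by (simp add: v_zero)
    next
      case False
      moreover have "y \<noteq> 0" using less v_nonneg[of x] by (auto simp: v_zero)
      ultimately obtain m n where mn: "v x = v \<pi> powi m" "v y = v \<pi> powi n"
        using \<pi>(3) by metis
      have "m \<ge> n + 1"
      proof (rule ccontr)
        assume "\<not> ?thesis"
        then have "v \<pi> powi n \<le> v \<pi> powi m"
          using \<pi>(1,2) by (intro power_int_decreasing) auto
        then show False using less mn by simp
      qed
      then have "v \<pi> powi m \<le> v \<pi> powi (n + 1)"
        using \<pi>(1,2) by (intro power_int_decreasing) auto
      also have "\<dots> = v \<pi> * v \<pi> powi n"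
        using \<pi>(1) by (simp add: power_int_add)
      finally show ?thesis by (simp add: mn)
    qed
  qed
qed

lemma finite_residues: "\<exists>X. finite X \<and> (\<forall>x. v x \<le> 1 \<longrightarrow> (\<exists>a\<in>X. v (x - a) < 1))"
proof -
  let ?R = "{(x, y). v x \<le> 1 \<and> v y \<le> 1 \<and> v (x - y) < 1}"
  let ?X = "(\<lambda>c. SOME a. a \<in> c) ` ({x. v x \<le> 1} // ?R)"
  have "\<exists>a\<in>?X. v (x - a) < 1" if x: "v x \<le> 1" for x
  proof -
    let ?c = "?R `` {x}"
    have "?c \<in> {x. v x \<le> 1} // ?R"
      using x by (intro quotientI) simp
    moreover have "x \<in> ?c"
      using x by (simp add: v_zero)
    then have "(SOME a. a \<in> ?c) \<in> ?c"
      by (rule someI)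
    ultimately show ?thesis
      by (intro bexI[of _ "SOME a. a \<in> ?c"] imageI) auto
  qed
  then show ?thesis
    using finite_residue_field by blast
qed

text \<open>Each induction step adds one digit of a \<open>\<pi>\<close>-adic expansion: the
  remainder \<open>x - b\<close>, divided by \<open>\<pi> ^ n * a\<close>, is integral, and its
  residue class supplies the next digit.\<close>

lemma finite_ball_quotient:
  assumes c: "c \<noteq> 0"
  shows "\<exists>X. finite X \<and> (\<forall>x. v x \<le> v a \<longrightarrow> (\<exists>b\<in>X. v (x - b) \<le> v c))"
proof -
  obtain \<pi> where \<pi>: "0 < v \<pi>" "v \<pi> < 1" "\<And>x y. v x < v y \<Longrightarrow> v x \<le> v \<pi> * v y"
    using uniformizer by metis
  then have "\<pi> \<noteq> 0" by (auto simp: v_zero)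
  obtain X where X: "finite X" "\<And>x. v x \<le> 1 \<Longrightarrow> \<exists>b\<in>X. v (x - b) < 1"
    using finite_residues by blast
  have step: "\<exists>Y. finite Y \<and> (\<forall>x. v x \<le> v a \<longrightarrow> (\<exists>b\<in>Y. v (x - b) \<le> v \<pi> ^ n * v a))" for n
  proof (induction n)
    case 0
    then show ?case
      by (intro exI[of _ "{0}"]) simp
  next
    case (Suc n)
    then obtain Y where Y: "finite Y" "\<And>x. v x \<le> v a \<Longrightarrow> \<exists>b\<in>Y. v (x - b) \<le> v \<pi> ^ n * v a"
      by blast
    define w where "w = \<pi> ^ n * a"
    show ?case
    proof (intro exI[of _ "(\<lambda>(b, e). b + w * e) ` (Y \<times> X)"] conjI allI impI)
      show "finite ((\<lambda>(b, e). b + w * e) ` (Y \<times> X))"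
        using X Y by simp
      fix x assume x: "v x \<le> v a"
      obtain b where b: "b \<in> Y" "v (x - b) \<le> v w"
        using Y(2)[OF x] by (auto simp: w_def v_mult v_power)
      show "\<exists>b\<in>(\<lambda>(b, e). b + w * e) ` (Y \<times> X). v (x - b) \<le> v \<pi> ^ Suc n * v a"
      proof (cases "a = 0")
        case True
        \<comment> \<open>Here \<open>w = 0\<close>, so any digit does; one is needed because the
          new set is an image of \<open>Y \<times> X\<close>.\<close>
        obtain e where "e \<in> X" using X(2)[of 0] by (auto simp: v_zero)
        then show ?thesis
          using b True by (intro bexI[of _ "b + w * e"]) (auto simp: w_def v_zero intro: rev_image_eqI)
      next
        case False
        then have d: "w \<noteq> 0" using \<open>\<pi> \<noteq> 0\<close> by (simp add: w_def)
        then have "v ((x - b) / w) \<le> 1"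
          using b v_pos[OF d] by (simp add: v_divide divide_le_eq)
        then obtain e where e: "e \<in> X" "v ((x - b) / w - e) < 1"
          using X(2) by blast
        then have "v ((x - b) / w - e) \<le> v \<pi>"
          using \<pi>(3)[of _ 1] by (simp add: v_one)
        then have "v (((x - b) / w - e) * w) \<le> v \<pi> * v w"
          using v_nonneg[of w] unfolding v_mult[of _ w] by (rule mult_right_mono)
        moreover have "((x - b) / w - e) * w = x - (b + w * e)"
          using d by (simp add: left_diff_distrib[of "(x - b) / w"])
        ultimately have "v (x - (b + w * e)) \<le> v \<pi> * v w"
          by (simp only:)
        also have "\<dots> = v \<pi> ^ Suc n * v a"
          by (simp add: w_def v_mult v_power)
        finally have "v (x - (b + w * e)) \<le> v \<pi> ^ Suc n * v a" .
        then show ?thesis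
          using b e unfolding w_def by (intro bexI[of _ "b + \<pi> ^ n * a * e"]) (auto intro: rev_image_eqI)
      qed
    qed
  qed
  \<comment> \<open>The summand 1 keeps the denominator positive when \<open>a = 0\<close>.\<close>
  obtain n where "v \<pi> ^ n < v c / (v a + 1)"
    using real_arch_pow_inv[of "v c / (v a + 1)" "v \<pi>"] \<pi>(2) v_pos[OF c] v_nonneg[of a] by auto
  then have "v \<pi> ^ n * (v a + 1) < v c"
    using v_nonneg[of a] by (simp add: less_divide_eq add_nonneg_pos)
  moreover have "v \<pi> ^ n * v a \<le> v \<pi> ^ n * (v a + 1)"
    using \<pi>(1) by (intro mult_left_mono) auto
  ultimately have "v \<pi> ^ n * v a \<le> v c" by simp
  then show ?thesis
    using step[of n] by (meson order_trans)
qed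

lemma small_element:
  assumes "0 < r"
  obtains c where "c \<noteq> 0" "v c < r"
proof -
  obtain \<pi> where \<pi>: "0 < v \<pi>" "v \<pi> < 1" "\<And>x y. v x < v y \<Longrightarrow> v x \<le> v \<pi> * v y"
    using uniformizer by metis
  obtain n where "v \<pi> ^ n < r"
    using real_arch_pow_inv[OF assms \<pi>(2)] by auto
  then show ?thesis
    using \<pi>(1) by (intro that[of "\<pi> ^ n"]) (auto simp: v_power v_zero)
qed

lemma p_power_small:
  assumes "0 < r"
  obtains k where "v (of_nat (p ^ k)) < r"
  using real_arch_pow_inv[OF assms residue_char(2)] by (auto simp: v_power)

text \<open>The balls on which \<psi> is trivial form a chain: smoothness gives one, nontriviality
  bounds them, and discreteness yields a largest, of radius \<open>v d\<close>. Rescaling by a turns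
  this into the orthogonal of the ball of radius \<open>v a\<close>.\<close>

lemma conductor:
  fixes \<psi> :: "'f \<Rightarrow> 'r::field"
  assumes smooth: "smooth_character metric.mtopology \<psi>" and nontriv: "\<exists>t. \<psi> t \<noteq> 1"
  obtains d where "d \<noteq> 0"
    "\<And>a y. a \<noteq> 0 \<Longrightarrow> (\<forall>x. v x \<le> v a \<longrightarrow> \<psi> (x * y) = 1) \<longleftrightarrow> v y \<le> v (d / a)"
proof -
  note psi = smooth_characterD[OF smooth]
  obtain \<pi> where \<pi>: "0 < v \<pi>" "v \<pi> < 1" "\<And>x y. v x < v y \<Longrightarrow> v x \<le> v \<pi> * v y"
    using uniformizer by metis
  then have "\<pi> \<noteq> 0" by (auto simp: v_zero)
  obtain t where t: "\<psi> t \<noteq> 1" using nontriv by blast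
  then have "t \<noteq> 0" using psi(4) by auto
  obtain r where r: "r > 0" "\<And>x. v x < r \<Longrightarrow> \<psi> x = 1"
    using open_0_ball[OF psi(3)] psi(4) by (metis (mono_tags, lifting) mem_Collect_eq subset_iff)
  define K where "K = (\<lambda>z. \<forall>x. v x \<le> v z \<longrightarrow> \<psi> x = 1)"
  have K_mono: "K y" if "K z" "v y \<le> v z" for y z
    using that by (auto simp: K_def)
  obtain c where c: "c \<noteq> 0" "v c < r"
    using small_element[OF r(1)] by blast
  have "\<exists>n. \<not> K (c / \<pi> ^ n)"
  proof -
    obtain n where n: "v \<pi> ^ n < v c / v t"
      using real_arch_pow_inv[OF _ \<pi>(2), of "v c / v t"] v_pos[OF c(1)] v_pos[OF \<open>t \<noteq> 0\<close>] by auto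
    have "v t \<le> v (c / \<pi> ^ n)"
      using n \<pi>(1) v_pos[OF \<open>t \<noteq> 0\<close>] by (simp add: v_divide v_power field_simps)
    then show ?thesis using t by (auto simp: K_def)
  qed
  moreover have "K (c / \<pi> ^ 0)"
    using c r(2) by (auto simp: K_def)
  \<comment> \<open>The balls given by \<open>c / \<pi> ^ n\<close> grow with n, from one inside the
    kernel of \<psi> to one containing t; d is taken where triviality is lost.\<close>
  ultimately obtain n where n: "K (c / \<pi> ^ n)" "\<not> K (c / \<pi> ^ Suc n)"
    using nat_induct[of "\<lambda>n. K (c / \<pi> ^ n)"] by blast
  define d where "d = c / \<pi> ^ n"
  have d: "d \<noteq> 0" "K d" "\<not> K (d / \<pi>)"
    using n c \<open>\<pi> \<noteq> 0\<close> by (auto simp: d_def mult.commute)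
  have K_iff: "K z \<longleftrightarrow> v z \<le> v d" for z
  proof
    assume "K z"
    show "v z \<le> v d"
    proof (rule ccontr)
      assume "\<not> ?thesis"
      then have "v d \<le> v \<pi> * v z" using \<pi>(3) by simp
      then have "v (d / \<pi>) \<le> v z" using \<pi>(1) by (simp add: v_divide field_simps)
      then show False using K_mono[OF \<open>K z\<close>] d(3) by blast
    qed
  qed (use K_mono d in blast)
  show ?thesis
  proof (rule that[OF d(1)])
    fix a y :: 'f assume a: "a \<noteq> 0"
    have "(\<forall>x. v x \<le> v a \<longrightarrow> \<psi> (x * y) = 1) \<longleftrightarrow> K (a * y)"
    proof (cases "y = 0")
      case True
      have "x = 0" if "v x \<le> 0" for x
        using that v_pos[of x] by fastforce
      then show ?thesis using True psi(4) by (auto simp: K_def v_zero)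
    next
      case False
      show ?thesis
      proof (intro iffI allI impI)
        assume h: "\<forall>x. v x \<le> v a \<longrightarrow> \<psi> (x * y) = 1"
        show "K (a * y)"
          unfolding K_def
        proof (intro allI impI)
          fix z assume "v z \<le> v (a * y)"
          then have "v (z / y) \<le> v a"
            using v_pos[OF False] by (simp add: v_divide v_mult field_simps)
          then show "\<psi> z = 1" using h False by force
        qed
      next
        fix x assume "K (a * y)" "v x \<le> v a"
        moreover from this have "v (x * y) \<le> v (a * y)"
          using v_nonneg[of y] by (simp add: v_mult mult_right_mono)
        ultimately show "\<psi> (x * y) = 1" by (auto simp: K_def)
      qed
    qed
    also have "\<dots> \<longleftrightarrow> v y \<le> v (d / a)"
      using v_pos[OF a] by (simp add: K_iff v_mult v_divide field_simps)
    finally show "(\<forall>x. v x \<le> v a \<longrightarrow> \<psi> (x * y) = 1) \<longleftrightarrow> v y \<le> v (d / a)" .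
  qed
qed

text \<open>A and D are the balls of radius 1 and \<open>v d\<close>, with d from the conductor.
  Balls of positive radius are their own double orthogonals, so small balls serve as sublattices,
  and powers of p contract into them because \<open>v (of_nat p) < 1\<close>.\<close>

lemma dual_lattices_local:
  fixes \<psi> :: "'f \<Rightarrow> 'r::field"
  assumes smooth: "smooth_character metric.mtopology \<psi>" and nontriv: "\<exists>t. \<psi> t \<noteq> 1"
    and two: "(2::'f) \<noteq> 0"
  shows "\<exists>A D. dual_lattices metric.mtopology \<psi> p A D"
proof -
  note psi = smooth_characterD[OF smooth]
  obtain d where d: "d \<noteq> 0"
    "\<And>a y. a \<noteq> 0 \<Longrightarrow> (\<forall>x. v x \<le> v a \<longrightarrow> \<psi> (x * y) = 1) \<longleftrightarrow> v y \<le> v (d / a)"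
    using conductor[OF smooth nontriv] by blast
  define ball where "ball = (\<lambda>a. {x. v x \<le> v a})"
  have perp: "(\<forall>x\<in>ball a. \<psi> (x * y) = 1) \<longleftrightarrow> y \<in> ball (d / a)" if "a \<noteq> 0" for a y
    using d(2)[OF that] by (auto simp: ball_def)
  have subgroup: "add_subgroup (ball a)" for a
    by (auto simp: add_subgroup_def ball_def v_zero v_nonneg v_diff_le)
  obtain r where r: "r > 0" "\<And>x. v x < r \<Longrightarrow> \<psi> x = 1"
    using open_0_ball[OF psi(3)] psi(4) by (metis (mono_tags, lifting) mem_Collect_eq subset_iff)
  have sub: "\<exists>C' k X. C' \<subseteq> ball a \<inter> B \<and> add_subgroup C' \<and>
        (\<forall>x. (\<forall>y. (\<forall>c\<in>C'. \<psi> (c * y) = 1) \<longrightarrow> \<psi> (x * y) = 1) \<longrightarrow> x \<in> C') \<and>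
        (\<forall>x\<in>ball a. of_nat (p ^ k) * x \<in> C') \<and>
        finite X \<and> (\<forall>x\<in>ball a. \<exists>a\<in>X. x - a \<in> C')"
    if B: "openin metric.mtopology B" "0 \<in> B" and a: "a \<noteq> 0" for a B
  proof -
    obtain s where s: "s > 0" "{x. v x < s} \<subseteq> B"
      using open_0_ball[OF B] by blast
    obtain c where c: "c \<noteq> 0" "v c < min s (v a)"
      using small_element[of "min s (v a)"] s v_pos[OF a] by auto
    obtain k where k: "v (of_nat (p ^ k)) < v c / v a"
      using p_power_small[of "v c / v a"] v_pos[OF c(1)] v_pos[OF a] by auto
    obtain X where X: "finite X" "\<And>x. v x \<le> v a \<Longrightarrow> \<exists>b\<in>X. v (x - b) \<le> v c"
      using finite_ball_quotient[OF c(1)] by blast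
    have "x \<in> ball c" if "\<forall>y. (\<forall>z\<in>ball c. \<psi> (z * y) = 1) \<longrightarrow> \<psi> (x * y) = 1" for x
    proof -
      have "\<forall>y\<in>ball (d / c). \<psi> (y * x) = 1"
        using that perp[OF c(1)] by (simp add: mult.commute)
      then have "x \<in> ball (d / (d / c))"
        using perp[of "d / c" x] d(1) c(1) by simp
      then show ?thesis using d(1) by simp
    qed
    moreover have "of_nat (p ^ k) * x \<in> ball c" if "x \<in> ball a" for x
    proof -
      have "v (of_nat (p ^ k)) * v x \<le> v c / v a * v a"
        using k that by (intro mult_mono) (auto simp: ball_def v_nonneg)
      then show ?thesis
        using v_pos[OF a] by (simp add: ball_def v_mult)
    qed
    moreover have "ball c \<subseteq> ball a \<inter> B"
      using c s by (auto simp: ball_def)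
    moreover have "\<forall>x\<in>ball a. \<exists>b\<in>X. x - b \<in> ball c"
      using X(2) by (simp add: ball_def)
    ultimately show ?thesis
      using subgroup[of c] X(1) by blast
  qed
  have "dual_lattices metric.mtopology \<psi> p (ball 1) (ball d)"
  proof
    show "(of_nat p :: 'r) \<noteq> 0"
    proof
      assume p0: "(of_nat p :: 'r) = 0"
      obtain t where t: "\<psi> t \<noteq> 1" using nontriv by blast
      then have "t \<noteq> 0" using psi(4) by auto
      obtain k where k: "v (of_nat (p ^ k)) < r / v t"
        using p_power_small[of "r / v t"] r(1) v_pos[OF \<open>t \<noteq> 0\<close>] by auto
      then have "\<psi> (of_nat (p ^ k) * t) = 1"
        using v_pos[OF \<open>t \<noteq> 0\<close>] by (intro r(2)) (simp add: v_mult field_simps)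
      then show False
        using power_prime_eq_1_imp_eq_1[OF residue_char(1) p0] t psi(5) by metis
    qed
    show "\<exists>B. openin metric.mtopology B \<and> add_subgroup B \<and> B \<subseteq> U"
      if U: "openin metric.mtopology U" "0 \<in> U" for U
    proof -
      obtain s where s: "s > 0" "{x. v x < s} \<subseteq> U"
        using open_0_ball[OF U] by blast
      then show ?thesis
        using open_ball[of s] by (intro exI[of _ "{x. v x < s}"])
          (auto simp: add_subgroup_def v_zero v_diff_less)
    qed
    show "x \<in> ball 1 \<longleftrightarrow> (\<forall>y\<in>ball d. \<psi> (x * y) = 1)" for x
      using perp[OF d(1), of x] d(1) by (simp add: mult.commute)
    show "y \<in> ball d \<longleftrightarrow> (\<forall>x\<in>ball 1. \<psi> (x * y) = 1)" for y
      using perp[of 1 y] by simp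
    show "\<exists>B. openin metric.mtopology B \<and> 0 \<in> B \<and>
      (\<forall>x\<in>insert 1 (ball 1 \<union> ball d). \<forall>b\<in>B. x * b / 2 \<in> ball 1 \<inter> ball d)"
    proof -
      \<comment> \<open>\<open>A \<inter> D\<close> is the ball of radius m, while M bounds the
        values of 1 and of all elements of A and D; together they give the radius
        \<open>?s\<close>.\<close>
      define m where "m = min 1 (v d)"
      define M where "M = max 1 (v d)"
      have m: "0 < m" using v_pos[OF d(1)] by (simp add: m_def)
      have M: "0 < M" by (simp add: M_def)
      let ?s = "m * v 2 / M"
      have "0 < ?s" using m M v_pos[OF two] by simp
      moreover have "x * b / 2 \<in> ball 1 \<inter> ball d" if "x \<in> insert 1 (ball 1 \<union> ball d)" "v b < ?s" for x b
      proof -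
        have "v x * v b \<le> M * ?s"
          using that M by (intro mult_mono) (auto simp: ball_def M_def v_one v_nonneg)
        then have "v (x * b / 2) \<le> m"
          using M v_pos[OF two] by (simp add: v_mult v_divide field_simps)
        then show ?thesis by (auto simp: ball_def m_def v_one)
      qed
      ultimately show ?thesis
        using open_ball[of ?s] by (intro exI[of _ "{x. v x < ?s}"]) (auto simp: v_zero)
    qed
    show "\<exists>C' k X. C' \<subseteq> C \<inter> B \<and> add_subgroup C' \<and>
        (\<forall>x. (\<forall>y. (\<forall>c\<in>C'. \<psi> (c * y) = 1) \<longrightarrow> \<psi> (x * y) = 1) \<longrightarrow> x \<in> C') \<and>
        (\<forall>x\<in>C. of_nat (p ^ k) * x \<in> C') \<and>
        finite X \<and> (\<forall>x\<in>C. \<exists>a\<in>X. x - a \<in> C')"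
      if "C \<in> {ball 1, ball d}" "openin metric.mtopology B" "0 \<in> B" for C B
    proof -
      obtain a where a: "a \<noteq> 0" "C = ball a"
        using \<open>C \<in> _\<close> d(1) by (metis insertE singletonD zero_neq_one)
      show ?thesis
        unfolding a(2) by (rule sub[OF that(2,3) a(1)])
    qed
  qed (use psi two residue_char open_affine in auto)
  then show ?thesis by blast
qed

end

text \<open>If \<open>x \<noteq> 0\<close>, the products \<open>x * y\<close> take every value,
  including one where \<psi> is not 1, so the orthogonal of the whole field is 0. As p vanishes in
  the field, \<open>{0}\<close> with \<open>k = 1\<close> is a sublattice of the required
  kind.\<close>

lemma dual_lattices_finite:
  fixes \<psi> :: "'f::field \<Rightarrow> 'r::field"
  assumes fin: "finite (UNIV :: 'f set)" and p: "CHAR('f) = p"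
    and smooth: "smooth_character (discrete_topology UNIV) \<psi>" and nontriv: "\<exists>t. \<psi> t \<noteq> 1"
    and two: "(2::'f) \<noteq> 0"
  shows "dual_lattices (discrete_topology UNIV) \<psi> p UNIV {0}"
proof -
  note psi = smooth_characterD[OF smooth]
  have prime: "prime p"
    using finite_imp_CHAR_pos[OF fin] prime_CHAR_semidom[where ?'a = 'f] p by simp
  have p0: "(of_nat p :: 'f) = 0"
    using p by (metis of_nat_CHAR)
  obtain t where t: "\<psi> t \<noteq> 1" using nontriv by blast
  have perp: "x = 0" if "\<And>y. \<psi> (x * y) = 1" for x
    using t that[of "t / x"] by (cases "x = 0") auto
  show ?thesis
  proof
    show "(of_nat p :: 'r) \<noteq> 0"
    proof
      assume "(of_nat p :: 'r) = 0"
      moreover have "\<psi> t ^ (p ^ 1) = 1"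
        using psi(5)[of p t] p0 psi(4) by simp
      ultimately show False
        using power_prime_eq_1_imp_eq_1[OF prime] t by metis
    qed
    show "\<exists>C' k X. C' \<subseteq> C \<inter> B \<and> add_subgroup C' \<and>
        (\<forall>x. (\<forall>y. (\<forall>c\<in>C'. \<psi> (c * y) = 1) \<longrightarrow> \<psi> (x * y) = 1) \<longrightarrow> x \<in> C') \<and>
        (\<forall>x\<in>C. of_nat (p ^ k) * x \<in> C') \<and>
        finite X \<and> (\<forall>x\<in>C. \<exists>a\<in>X. x - a \<in> C')"
      if "C \<in> {UNIV, {0}}" "openin (discrete_topology UNIV) B" "0 \<in> B" for C B :: "'f set"
      using that fin perp p0 psi(4)
      by (intro exI[of _ "{0}"] exI[of _ 1] exI[of _ UNIV]) (auto simp: add_subgroup_def)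
    show "y \<in> {0} \<longleftrightarrow> (\<forall>x\<in>UNIV. \<psi> (x * y) = 1)" for y
      using perp[of y] psi(4) by (auto simp: mult.commute)
    show "\<exists>B. openin (discrete_topology UNIV) B \<and> add_subgroup B \<and> B \<subseteq> U"
      if "0 \<in> U" for U :: "'f set"
      using that by (intro exI[of _ "{0}"]) (auto simp: add_subgroup_def)
    show "\<exists>B. openin (discrete_topology UNIV) B \<and> (0::'f) \<in> B \<and>
        (\<forall>x\<in>insert 1 (UNIV \<union> {0}). \<forall>b\<in>B. x * b / 2 \<in> UNIV \<inter> {0})"
      by (intro exI[of _ "{0}"]) auto
  qed (use psi two prime in auto)
qed

lemma exists_dual_lattices:
  fixes \<psi> :: "'f::field \<Rightarrow> 'r::field"
  assumes base: "finite_or_local_field p TF" and char: "CHAR('f) \<noteq> 2"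
    and smooth: "smooth_character TF \<psi>" and nontriv: "\<exists>t. \<psi> t \<noteq> 1"
  shows "\<exists>A D. dual_lattices TF \<psi> p A D"
proof -
  have "(2::'f) \<noteq> 0"
  proof
    assume "(2::'f) = 0"
    then have "CHAR('f) dvd 2"
      by (metis of_nat_eq_0_iff_char_dvd of_nat_numeral)
    then show False
      using char CHAR_not_1'[where ?'a = 'f] two_is_prime_nat by (auto simp: prime_nat_iff)
  qed
  with base show ?thesis
    unfolding finite_or_local_field_def
    using dual_lattices_finite[of p \<psi>] nonarch_local_field.dual_lattices_local[of _ p \<psi>] smooth nontriv
    by blast
qed

section \<open>Eigenvectors and symplectic bases\<close>

text \<open>Applying \<open>T l\<close> and subtracting \<open>\<kappa> j l\<close> times the
  relation removes the term of j and rescales the others by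
  \<open>\<kappa> k l - \<kappa> j l\<close>, which is nonzero at \<open>k = i\<close>. The rescaled
  vectors are eigenvectors for the same characters, so induction applies. Zero vectors are allowed
  among the \<open>x i\<close>, so they can carry coefficients.\<close>

lemma (in vector_space) sum_simultaneous_eigenvectors_eq_0:
  assumes "finite I"
    and lin: "\<And>l. l \<in> \<Lambda> \<Longrightarrow> Vector_Spaces.linear scale scale (T l)"
    and eigen: "\<And>l i. l \<in> \<Lambda> \<Longrightarrow> i \<in> I \<Longrightarrow> T l (x i) = scale (\<kappa> i l) (x i)"
    and distinct: "\<And>i j. i \<in> I \<Longrightarrow> j \<in> I \<Longrightarrow> i \<noteq> j \<Longrightarrow> \<exists>l\<in>\<Lambda>. \<kappa> i l \<noteq> \<kappa> j l"
    and "sum x I = 0" "i \<in> I"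
  shows "x i = 0"
  using assms(1) eigen distinct assms(5,6)
proof (induction I arbitrary: x i rule: finite_induct)
  case (insert j I)
  have *: "x i = 0" if i: "i \<in> I" for i
  proof -
    obtain l where l: "l \<in> \<Lambda>" "\<kappa> i l \<noteq> \<kappa> j l"
      using insert.prems(2)[of i j] insert.hyps(2) i by auto
    interpret T: Vector_Spaces.linear scale scale "T l"
      by (rule lin[OF l(1)])
    have "(\<Sum>k\<in>insert j I. scale (\<kappa> k l) (x k)) = (\<Sum>k\<in>insert j I. T l (x k))"
      using l(1) insert.prems(1) by (intro sum.cong) auto
    also have "\<dots> = T l (sum x (insert j I))"
      by (simp only: T.sum)
    also have "\<dots> = 0"
      using insert.prems(3) T.zero by simp
    finally have "(\<Sum>k\<in>insert j I. scale (\<kappa> k l) (x k)) = 0" .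
    moreover have "scale (\<kappa> j l) (sum x (insert j I)) = 0"
      using insert.prems(3) by simp
    ultimately have "(\<Sum>k\<in>insert j I. scale (\<kappa> k l - \<kappa> j l) (x k)) = 0"
      by (simp add: scale_sum_right scale_left_diff_distrib sum_subtractf del: sum.insert)
    then have "(\<Sum>k\<in>I. scale (\<kappa> k l - \<kappa> j l) (x k)) = 0"
      using insert.hyps by simp
    moreover have "T m (scale (\<kappa> k l - \<kappa> j l) (x k)) = scale (\<kappa> k m) (scale (\<kappa> k l - \<kappa> j l) (x k))"
      if "m \<in> \<Lambda>" "k \<in> I" for m k
    proof -
      interpret Tm: Vector_Spaces.linear scale scale "T m"
        by (rule lin[OF that(1)])
      show ?thesis
        using insert.prems(1)[of m k] that by (simp add: Tm.scale mult.commute)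
    qed
    ultimately have "scale (\<kappa> i l - \<kappa> j l) (x i) = 0"
      using insert.IH[of "\<lambda>k. scale (\<kappa> k l - \<kappa> j l) (x k)" i] insert.prems(2) i by blast
    then show ?thesis
      using l(2) by simp
  qed
  moreover have "x j = 0"
    using * insert.hyps insert.prems(3) by simp
  ultimately show ?case
    using insert.prems(4) by blast
qed simp

text \<open>The discrete Fourier transform of \<open>v\<close>, \<open>T v\<close>, \<open>\<dots>\<close>, \<open>T\<^sup>p\<^sup>-\<^sup>1 v\<close>: its terms add up to \<open>p v\<close>.\<close>
lemma (in vector_space) prime_order_eigenvector:
  fixes \<zeta> :: 'a and T :: "'b \<Rightarrow> 'b"
  assumes p: "prime p" "(of_nat p :: 'a) \<noteq> 0" and \<zeta>: "\<zeta> ^ p = 1" "\<zeta> \<noteq> 1"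
    and lin: "Vector_Spaces.linear scale scale T" and v: "(T ^^ p) v = v" "v \<noteq> 0"
  obtains j s where "s \<noteq> 0" "scale (\<zeta> ^ j) (T s) = s"
    "s = (\<Sum>k<p. scale (\<zeta> ^ (j * k)) ((T ^^ k) v))"
proof -
  interpret T: Vector_Spaces.linear scale scale T by (rule lin)
  define s where "s = (\<lambda>j. \<Sum>k<p. scale (\<zeta> ^ (j * k)) ((T ^^ k) v))"
  have p0: "0 < p" using p(1) prime_gt_0_nat by blast
  \<comment> \<open>\<open>\<zeta>\<close> has exact order p: a Bezout relation
    \<open>k * x = p * y + 1\<close> would turn \<open>\<zeta> ^ k = 1\<close> into
    \<open>\<zeta> = 1\<close>.\<close>
  have root: "\<zeta> ^ k \<noteq> 1" if kp: "0 < k" "k < p" for k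
  proof
    assume k: "\<zeta> ^ k = 1"
    have "coprime k p"
      using that p(1) by (metis coprime_commute nat_dvd_not_less prime_imp_coprime)
    then obtain x y where "k * x = p * y + 1"
      using bezout_nat[of k p] kp(1) by (auto simp: coprime_iff_gcd_eq_1)
    then have "(\<zeta> ^ k) ^ x = (\<zeta> ^ p) ^ y * \<zeta>"
      by (metis power_add power_mult power_one_right)
    then show False using k \<zeta> by simp
  qed
  have orth: "(\<Sum>j<p. \<zeta> ^ (j * k)) = 0" if "0 < k" "k < p" for k
  proof -
    have "(\<zeta> ^ k - 1) * (\<Sum>j<p. (\<zeta> ^ k) ^ j) = (\<zeta> ^ k) ^ p - 1"
      by (rule power_diff_1_eq[symmetric])
    also have "\<dots> = (\<zeta> ^ p) ^ k - 1"
      by (simp add: mult.commute flip: power_mult)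
    finally show ?thesis
      using root[OF that] \<zeta>(1) by (simp add: mult.commute flip: power_mult)
  qed
  have "(\<Sum>j<p. s j) = (\<Sum>k<p. \<Sum>j<p. scale (\<zeta> ^ (j * k)) ((T ^^ k) v))"
    unfolding s_def by (rule sum.swap)
  also have "\<dots> = (\<Sum>k<p. scale (\<Sum>j<p. \<zeta> ^ (j * k)) ((T ^^ k) v))"
    by (simp add: scale_sum_left)
  also have "\<dots> = (\<Sum>k<p. if k = 0 then scale (of_nat p) v else 0)"
    by (rule sum.cong) (auto simp: orth)
  also have "\<dots> = scale (of_nat p) v"
    using p0 by simp
  finally have "(\<Sum>j<p. s j) \<noteq> 0"
    using p(2) v(2) by simp
  then obtain j where j: "s j \<noteq> 0"
    by (metis sum.neutral)
  \<comment> \<open>T together with the factor \<open>\<zeta> ^ j\<close> shifts the summation index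
    by one; the new term at p equals the old term at 0.\<close>
  have "scale (\<zeta> ^ j) (T (s j)) = (\<Sum>k<p. scale (\<zeta> ^ (j * Suc k)) ((T ^^ Suc k) v))"
    by (simp add: s_def T.sum T.scale scale_sum_right power_add)
  also have "\<dots> = (\<Sum>k\<in>{1..p}. scale (\<zeta> ^ (j * k)) ((T ^^ k) v))"
    by (rule sum.reindex_bij_witness[of _ "\<lambda>k. k - 1" Suc]) auto
  also have "\<dots> = (\<Sum>k\<in>{1..<p}. scale (\<zeta> ^ (j * k)) ((T ^^ k) v)) + scale (\<zeta> ^ (j * p)) ((T ^^ p) v)"
    using p0 by (simp add: sum.last_plus add.commute)
  also have "scale (\<zeta> ^ (j * p)) ((T ^^ p) v) = scale (\<zeta> ^ (j * 0)) ((T ^^ 0) v)"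
    using \<zeta>(1) v(1) by (simp add: mult.commute[of j] power_mult)
  also have "(\<Sum>k\<in>{1..<p}. scale (\<zeta> ^ (j * k)) ((T ^^ k) v)) + \<dots> = s j"
    using p0 by (simp add: s_def lessThan_atLeast0 sum.atLeast_Suc_lessThan)
  finally show ?thesis
    using that[of "s j" j] j by (simp add: s_def)
qed

text \<open>The eigenvector lemma for the field as a space over itself, with multiplication by
  \<open>\<eta>\<close>: the nonzero eigenvector can be cancelled.\<close>

lemma prime_root_of_unity_eq_power:
  fixes \<zeta> \<eta> :: "'r::field"
  assumes "prime p" "(of_nat p :: 'r) \<noteq> 0" "\<zeta> ^ p = 1" "\<zeta> \<noteq> 1" "\<eta> ^ p = 1"
  obtains j where "\<zeta> ^ j * \<eta> = 1"
proof -
  have lin: "Vector_Spaces.linear (*) (*) ((*) \<eta>)"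
    by unfold_locales (simp_all add: algebra_simps)
  have "((*) \<eta> ^^ k) 1 = \<eta> ^ k" for k
    by (induction k) auto
  then have "((*) \<eta> ^^ p) 1 = 1" using assms(5) by simp
  then show ?thesis
    by (rule vector_space_over_itself.prime_order_eigenvector[OF assms(1-4) lin, of 1])
      (auto intro: that)
qed

section \<open>Linear algebra of the symplectic space\<close>

context symplectic_space
begin

lemma form_simps [simp]:
  "form (a + b) c = form a c + form b c" "form c (a + b) = form c a + form c b"
  "form (scale x a) c = x * form a c" "form c (scale x a) = x * form c a"
  "form (a - b) c = form a c - form b c" "form c (a - b) = form c a - form c b"
  "form (- a) c = - form a c" "form c (- a) = - form c a"
  "form 0 c = 0" "form c 0 = 0" "form a a = 0"
proof -
  interpret l: Vector_Spaces.linear scale "(*)" "\<lambda>w. form w c" by (rule form_linear_left)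
  interpret r: Vector_Spaces.linear scale "(*)" "\<lambda>w. form c w" by (rule form_linear_right)
  show "form (a + b) c = form a c + form b c" "form c (a + b) = form c a + form c b"
    "form (scale x a) c = x * form a c" "form c (scale x a) = x * form c a"
    "form (a - b) c = form a c - form b c" "form c (a - b) = form c a - form c b"
    "form (- a) c = - form a c" "form c (- a) = - form c a"
    "form 0 c = 0" "form c 0 = 0" "form a a = 0"
    by (fact l.add r.add l.scale r.scale l.diff r.diff l.neg r.neg l.zero r.zero form_alternating)+
qed

lemma form_sum: "form (sum h I) c = (\<Sum>i\<in>I. form (h i) c)" "form c (sum h I) = (\<Sum>i\<in>I. form c (h i))"
  by (induction I rule: infinite_finite_induct; simp)+

lemma form_commute: "form a b = - form b a"
proof -
  have "form (a + b) (a + b) = form a a + form b a + (form a b + form b b)"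
    by (simp only: form_simps(1,2))
  then show ?thesis by (simp add: eq_neg_iff_add_eq_0 add.commute)
qed

lemma SpD:
  assumes "g \<in> Sp"
  shows "Vector_Spaces.linear scale scale g" "bij g" "form (g a) (g b) = form a b"
    "g (a + b) = g a + g b" "g (scale x a) = scale x (g a)" "g (a - b) = g a - g b"
    "inv g (g a) = a" "g (inv g a) = a" "inv g \<in> Sp" "form (inv g a) b = form a (g b)"
proof -
  show lin: "Vector_Spaces.linear scale scale g" and bij: "bij g"
    and form: "form (g a) (g b) = form a b" for a b
    using assms by (auto simp: Sp_def)
  interpret g: Vector_Spaces.linear scale scale g by (rule lin)
  show "g (a + b) = g a + g b" "g (scale x a) = scale x (g a)" "g (a - b) = g a - g b"
    by (fact g.add g.scale g.diff)+
  show i: "inv g (g a) = a" "g (inv g a) = a" for a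
    using bij by (simp_all add: bij_is_inj bij_is_surj surj_f_inv_f)
  have "inv g (a + b) = inv g a + inv g b" "inv g (scale x a) = scale x (inv g a)" for a b x
    using i g.add g.scale by metis+
  then have "Vector_Spaces.linear scale scale (inv g)"
    by (simp add: Vector_Spaces.linear_iff vector_space_axioms)
  then show "inv g \<in> Sp"
    using bij i form by (auto simp: Sp_def bij_imp_bij_inv) metis
  show "form (inv g a) b = form a (g b)"
    using form[of "inv g a" b] i by simp
qed

definition symplectic_family :: "nat \<Rightarrow> (nat \<Rightarrow> 'w) \<Rightarrow> (nat \<Rightarrow> 'w) \<Rightarrow> bool" where
  "symplectic_family n e f \<longleftrightarrow> (\<forall>i<n. \<forall>j<n. form (e i) (e j) = 0 \<and> form (f i) (f j) = 0 \<and>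
     form (e i) (f j) = (if i = j then 1 else 0))"

lemma symplectic_familyD:
  assumes "symplectic_family n e f" "i < n" "j < n"
  shows "form (e i) (e j) = 0" "form (f i) (f j) = 0" "form (e i) (f j) = (if i = j then 1 else 0)"
    "form (f i) (e j) = (if i = j then - 1 else 0)"
  using assms form_commute[of "f i" "e j"] by (auto simp: symplectic_family_def)

text \<open>Pairing a linear relation among the \<open>e i\<close> with one \<open>f i\<close>
  isolates one coefficient, so the \<open>e i\<close> are independent. Counting only this half is
  enough to make a family of maximal size exist.\<close>

lemma symplectic_family_bound:
  assumes ef: "symplectic_family n e f"
  shows "n \<le> card Basis"
proof -
  have inj: "inj_on e {..<n}"
  proof (rule inj_onI)
    fix i j assume ij: "i \<in> {..<n}" "j \<in> {..<n}" "e i = e j"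
    have "form (e i) (f i) = 1" "form (e j) (f i) = (if j = i then 1 else 0)"
      using symplectic_familyD(3)[OF ef, of _ i] ij(1,2) by auto
    then show "i = j"
      using ij(3) by (metis zero_neq_one)
  qed
  have "independent (e ` {..<n})"
    unfolding independent_explicit_finite_subsets
  proof (intro allI impI ballI)
    fix S c w assume S: "S \<subseteq> e ` {..<n}" "finite S" "(\<Sum>v\<in>S. scale (c v) v) = 0" "w \<in> S"
    then obtain i where i: "i < n" "w = e i" by auto
    have "0 = form (\<Sum>v\<in>S. scale (c v) v) (f i)"
      using S(3) by simp
    also have "\<dots> = (\<Sum>v\<in>S. if v = w then c v else 0)"
      unfolding form_sum
    proof (rule sum.cong)
      fix v assume "v \<in> S"
      then obtain j where j: "j < n" "v = e j" using S(1) by auto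
      moreover have "e j = e i \<longleftrightarrow> i = j"
        using inj i(1) j(1) by (auto dest: inj_onD)
      ultimately show "form (scale (c v) v) (f i) = (if v = w then c v else 0)"
        using symplectic_familyD(3)[OF ef j(1) i(1)] i(2) by auto
    qed simp
    also have "\<dots> = c w" using S by simp
    finally show "c w = 0" by simp
  qed
  then have "card (e ` {..<n}) \<le> card Basis"
    using independent_span_bound[OF finite_Basis] span_Basis by auto
  then show ?thesis
    by (simp add: card_image[OF inj])
qed

text \<open>A symplectic family of maximal size spans: a vector \<open>w\<close> orthogonal to it, together with
  a partner \<open>u\<close> of \<open>w\<close>, made orthogonal to the family, would enlarge it.\<close>
lemma symplectic_basis:
  obtains n e f where "symplectic_family n e f"
    "\<And>w. w = (\<Sum>i<n. scale (form w (f i)) (e i) + scale (form (e i) w) (f i))"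
proof -
  let ?P = "\<lambda>n. \<exists>e f. symplectic_family n e f"
  have "?P 0" by (simp add: symplectic_family_def)
  moreover have "\<forall>m. ?P m \<longrightarrow> m \<le> card Basis"
    using symplectic_family_bound by blast
  ultimately obtain n where n: "?P n" "\<And>m. ?P m \<Longrightarrow> m \<le> n"
    using GreatestI_nat[of ?P 0 "card Basis"] Greatest_le_nat[of ?P _ "card Basis"] by blast
  then obtain e f where ef: "symplectic_family n e f" by blast
  define pr where "pr = (\<lambda>w. w - (\<Sum>i<n. scale (form w (f i)) (e i) + scale (form (e i) w) (f i)))"
  have orth: "form (pr w) (e j) = 0" "form (pr w) (f j) = 0" if j: "j < n" for w j
  proof -
    have "form (\<Sum>i<n. scale (form w (f i)) (e i) + scale (form (e i) w) (f i)) (e j)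
        = (\<Sum>i<n. if i = j then - form (e j) w else 0)"
      unfolding form_sum using symplectic_familyD[OF ef _ j] by (intro sum.cong) auto
    then show "form (pr w) (e j) = 0"
      using j form_commute[of w "e j"] by (simp add: pr_def)
    have "form (\<Sum>i<n. scale (form w (f i)) (e i) + scale (form (e i) w) (f i)) (f j)
        = (\<Sum>i<n. if i = j then form w (f j) else 0)"
      unfolding form_sum using symplectic_familyD[OF ef _ j] by (intro sum.cong) auto
    then show "form (pr w) (f j) = 0"
      using j by (simp add: pr_def)
  qed
  have "pr w = 0" for w
  proof (rule ccontr)
    assume "pr w \<noteq> 0"
    then obtain u where u: "form (pr w) u \<noteq> 0"
      using form_nondegenerate by blast
    \<comment> \<open>\<open>pr u\<close> differs from u by a combination of the family, to which
      \<open>pr w\<close> is orthogonal; so both pair alike with \<open>pr w\<close>.\<close>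
    have "pr u = u - (\<Sum>i<n. scale (form u (f i)) (e i) + scale (form (e i) u) (f i))"
      by (simp add: pr_def)
    then have "form (pr w) (pr u) = form (pr w) u"
      by (simp add: form_sum orth)
    then have pu: "form (pr w) (pr u) \<noteq> 0" using u by simp
    define e' where "e' = e(n := pr w)"
    define f' where "f' = f(n := scale (1 / form (pr w) (pr u)) (pr u))"
    have orth': "form (e j) (pr w) = 0" "form (f j) (pr w) = 0" if "j < n" for j w
      using orth[OF that] form_commute[of _ "pr w"] by simp_all
    have "symplectic_family (Suc n) e' f'"
      using ef pu by (auto simp: symplectic_family_def e'_def f'_def less_Suc_eq orth orth')
    then show False
      using n(2)[of "Suc n"] by auto
  qed
  then show ?thesis
    using that[OF ef] by (simp add: pr_def)
qed

end

section \<open>Weyl systems and self-dual lattices\<close>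

text \<open>\<open>L\<close> is its own orthogonal for \<open>\<psi> \<circ> form\<close>, and \<open>\<theta>\<close> is a character of the
  commutative image of \<open>L\<close> in the Heisenberg group modulo the kernel of \<open>\<psi>\<close>.\<close>
locale weyl_lattice =
  W: symplectic_space scaleW Basis form + S: vector_space scaleS
  for scaleW :: "'f::field \<Rightarrow> 'w::ab_group_add \<Rightarrow> 'w" and Basis form
    and scaleS :: "'r::field \<Rightarrow> 's::ab_group_add \<Rightarrow> 's" +
  fixes \<psi> :: "'f \<Rightarrow> 'r" and L :: "'w set" and \<theta> :: "'w \<Rightarrow> 'r"
  assumes psi_add: "\<psi> (x + y) = \<psi> x * \<psi> y"
    and psi_nonzero: "\<psi> x \<noteq> 0"
    and two_nonzero: "(2::'f) \<noteq> 0"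
    and L_subgroup: "add_subgroup L"
    and L_perp: "w \<in> L \<longleftrightarrow> (\<forall>l\<in>L. \<psi> (form l w) = 1)"
    and theta_add: "l \<in> L \<Longrightarrow> l' \<in> L \<Longrightarrow> \<theta> l * \<theta> l' = \<psi> (form l l' / 2) * \<theta> (l + l')"
    and theta_nonzero: "l \<in> L \<Longrightarrow> \<theta> l \<noteq> 0"
begin

sublocale SS: vector_space_pair scaleS scaleS ..

lemmas psi_simps = character_simps[of \<psi>, OF psi_nonzero psi_add]

lemma L_isotropic: "l \<in> L \<Longrightarrow> l' \<in> L \<Longrightarrow> \<psi> (form l l') = 1"
  using L_perp by blast

lemma theta_zero: "\<theta> 0 = 1"
  using theta_add[of 0 0] theta_nonzero[of 0] add_subgroupD[OF L_subgroup] by (simp add: psi_simps)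

lemma subgroup_scale_of_nat: "add_subgroup N \<Longrightarrow> x \<in> N \<Longrightarrow> scaleW (of_nat k) x \<in> N"
  by (induction k) (simp_all add: add_subgroupD W.scale_left_distrib)

lemma subgroup_scale_of_int:
  assumes "add_subgroup N" "x \<in> N"
  shows "scaleW (of_int k) x \<in> N"
proof (cases k)
  case (nonneg n)
  then show ?thesis using subgroup_scale_of_nat[OF assms, of n] by simp
next
  case (neg n)
  then show ?thesis
    using add_subgroupD(2)[OF assms(1) subgroup_scale_of_nat[OF assms, of "Suc n"]]
    by (simp add: W.scale_minus_left del: of_nat_Suc)
qed

lemma theta_scale_of_nat: "x \<in> L \<Longrightarrow> \<theta> (scaleW (of_nat k) x) = \<theta> x ^ k"
proof (induction k)
  case (Suc k)
  have "\<theta> x * \<theta> (scaleW (of_nat k) x) = \<theta> (x + scaleW (of_nat k) x)"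
    using theta_add[of x "scaleW (of_nat k) x"] Suc.prems subgroup_scale_of_nat[OF L_subgroup Suc.prems]
    by (simp add: psi_simps)
  then show ?case
    using Suc by (simp add: W.scale_left_distrib)
qed (simp add: theta_zero)

text \<open>The operators of the elements \<open>(w, 0)\<close> in a representation of the
  Heisenberg group with central character \<psi>; the centre is absorbed into the cocycle.\<close>

definition weyl_system :: "('w \<Rightarrow> 's \<Rightarrow> 's) \<Rightarrow> bool" where
  "weyl_system \<pi> \<longleftrightarrow> (\<forall>w. Vector_Spaces.linear scaleS scaleS (\<pi> w)) \<and>
     (\<forall>w w' s. \<pi> w (\<pi> w' s) = scaleS (\<psi> (form w w' / 2)) (\<pi> (w + w') s)) \<and> (\<forall>s. \<pi> 0 s = s)"

definition irreducible_system :: "('w \<Rightarrow> 's \<Rightarrow> 's) \<Rightarrow> bool" where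
  "irreducible_system \<pi> \<longleftrightarrow> weyl_system \<pi> \<and>
     (\<forall>U. S.subspace U \<longrightarrow> (\<forall>w. \<pi> w ` U \<subseteq> U) \<longrightarrow> U = {0} \<or> U = UNIV)"

definition lattice_vector :: "('w \<Rightarrow> 's \<Rightarrow> 's) \<Rightarrow> 's \<Rightarrow> bool" where
  "lattice_vector \<pi> u \<longleftrightarrow> u \<noteq> 0 \<and> (\<forall>l\<in>L. \<pi> l u = scaleS (\<theta> l) u)"

definition perp :: "'w set \<Rightarrow> 'w set" where
  "perp N = {w. \<forall>n\<in>N. \<psi> (form n w) = 1}"

text \<open>N is its own double orthogonal; the reverse inclusion holds for every set.\<close>

definition perp_closed :: "'w set \<Rightarrow> bool" where
  "perp_closed N \<longleftrightarrow> (\<forall>z. (\<forall>y\<in>perp N. \<psi> (form z y) = 1) \<longrightarrow> z \<in> N)"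

lemma weyl_systemD:
  assumes "weyl_system \<pi>"
  shows "Vector_Spaces.linear scaleS scaleS (\<pi> w)"
    "\<pi> w (\<pi> w' s) = scaleS (\<psi> (form w w' / 2)) (\<pi> (w + w') s)"
    "\<pi> 0 s = s" "\<pi> w (scaleS c s) = scaleS c (\<pi> w s)" "\<pi> w (s + s') = \<pi> w s + \<pi> w s'"
    "\<pi> w (sum h I) = (\<Sum>i\<in>I. \<pi> w (h i))"
    "\<pi> w (\<pi> w' s) = scaleS (\<psi> (form w w')) (\<pi> w' (\<pi> w s))"
    "\<pi> (- w) (\<pi> w s) = s" "\<pi> w s = 0 \<longleftrightarrow> s = 0"
proof -
  show lin: "Vector_Spaces.linear scaleS scaleS (\<pi> w)"
    and mult: "\<pi> w (\<pi> w' s) = scaleS (\<psi> (form w w' / 2)) (\<pi> (w + w') s)"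
    and zero: "\<pi> 0 s = s" for w w' s
    using assms by (auto simp: weyl_system_def)
  interpret l: Vector_Spaces.linear scaleS scaleS "\<pi> w" by (rule lin)
  show "\<pi> w (scaleS c s) = scaleS c (\<pi> w s)" "\<pi> w (s + s') = \<pi> w s + \<pi> w s'"
    "\<pi> w (sum h I) = (\<Sum>i\<in>I. \<pi> w (h i))"
    by (fact l.scale l.add l.sum)+
  \<comment> \<open>Comparing the cocycle for both orders of w and w' yields the commutation
    relation, with factor \<open>\<psi> (form w w')\<close>.\<close>
  have "form w w' / 2 = form w w' + form w' w / 2"
    using two_nonzero W.form_commute[of w' w] by (simp add: field_simps)
  then have "\<psi> (form w w' / 2) = \<psi> (form w w') * \<psi> (form w' w / 2)"
    by (metis psi_add)
  then show "\<pi> w (\<pi> w' s) = scaleS (\<psi> (form w w')) (\<pi> w' (\<pi> w s))"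
    by (simp add: mult add.commute)
  show inv: "\<pi> (- w) (\<pi> w s) = s"
    by (simp add: mult zero psi_simps)
  show "\<pi> w s = 0 \<longleftrightarrow> s = 0"
    using inv l.zero by (metis lin SS.linear_0)
qed

section \<open>Orbits of lattice vectors, intertwiners and Schur's lemma\<close>

lemma irreducible_systemD: "irreducible_system \<pi> \<Longrightarrow> weyl_system \<pi>"
  by (simp add: irreducible_system_def)

text \<open>The span of the orbit is invariant, since \<open>\<pi> w (\<pi> w' u)\<close> is a
  multiple of \<open>\<pi> (w + w') u\<close>, and it contains u.\<close>

lemma span_orbit:
  assumes irr: "irreducible_system \<pi>" and u: "u \<noteq> 0"
  shows "S.span (range (\<lambda>w. \<pi> w u)) = UNIV"
proof -
  note \<pi> = weyl_systemD[OF irreducible_systemD[OF irr]]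
  let ?U = "S.span (range (\<lambda>w. \<pi> w u))"
  have "\<pi> w ` ?U \<subseteq> ?U" for w
  proof -
    have "\<pi> w (\<pi> w' u) \<in> ?U" for w'
      by (subst \<pi>(2)) (intro S.span_scale S.span_base rangeI)
    then have "S.span (\<pi> w ` range (\<lambda>w. \<pi> w u)) \<subseteq> ?U"
      by (intro S.span_minimal) auto
    then show ?thesis
      using SS.linear_span_image[OF \<pi>(1)] by simp
  qed
  moreover have "u \<in> ?U"
    using \<pi>(3)[of u] S.span_base by (metis rangeI)
  ultimately show ?thesis
    using irr u S.subspace_span unfolding irreducible_system_def by blast
qed

text \<open>For two vectors of one coset of L the predicates under \<open>SOME\<close> coincide, so
  the range is a system of representatives of W modulo L.\<close>

definition coset_rep :: "'w \<Rightarrow> 'w" where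
  "coset_rep w = (SOME x. x - w \<in> L)"

lemma coset_rep: "coset_rep w - w \<in> L" "w - coset_rep w \<in> L"
proof -
  show "coset_rep w - w \<in> L"
    unfolding coset_rep_def by (rule someI[of _ w]) (simp add: add_subgroupD(1)[OF L_subgroup])
  then show "w - coset_rep w \<in> L"
    using add_subgroupD(2)[OF L_subgroup, of "coset_rep w - w"] by simp
qed

lemma coset_rep_eqI:
  assumes "x \<in> range coset_rep" "y \<in> range coset_rep" "x - y \<in> L"
  shows "x = y"
proof -
  obtain a b where ab: "x = coset_rep a" "y = coset_rep b" using assms by auto
  have "a - b = (a - x) + (x - y) + (y - b)" by simp
  also have "\<dots> \<in> L"
    using coset_rep[of a] coset_rep[of b] assms(3) ab add_subgroupD(3)[OF L_subgroup] by metis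
  finally have ab': "a - b \<in> L" .
  have "z - a \<in> L \<longleftrightarrow> z - b \<in> L" for z
    using add_subgroupD(3,4)[OF L_subgroup _ ab', of "z - a"]
      add_subgroupD(3,4)[OF L_subgroup _ ab', of "z - b"] by (auto simp: algebra_simps)
  then show ?thesis
    by (simp add: ab coset_rep_def)
qed

text \<open>Commuting l past w contributes \<open>\<psi> (form l w)\<close>, so translating u twists
  the character \<open>\<theta>\<close> by w.\<close>

lemma translate_eigen:
  assumes \<pi>: "weyl_system \<pi>" and u: "lattice_vector \<pi> u" and l: "l \<in> L"
  shows "\<pi> l (\<pi> w u) = scaleS (\<psi> (form l w) * \<theta> l) (\<pi> w u)"
  using u l by (subst weyl_systemD(7)[OF \<pi>]) (simp add: lattice_vector_def weyl_systemD(4)[OF \<pi>])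

lemma separating_lattice_element:
  assumes "x \<in> range coset_rep" "y \<in> range coset_rep" "x \<noteq> y"
  obtains l where "l \<in> L" "\<psi> (form l x) * \<theta> l \<noteq> \<psi> (form l y) * \<theta> l"
proof -
  have "x - y \<notin> L"
    using coset_rep_eqI assms by blast
  then obtain l where l: "l \<in> L" "\<psi> (form l (x - y)) \<noteq> 1"
    using L_perp by blast
  then show ?thesis
    using that[of l] theta_nonzero[of l] psi_nonzero by (simp add: psi_simps)
qed

text \<open>The translates are eigenvectors of \<open>L\<close> with distinct characters, because \<open>L\<close> is its own
  orthogonal.\<close>
lemma coset_rep_translates_independent:
  assumes \<pi>: "weyl_system \<pi>" and u: "lattice_vector \<pi> u"
    and I: "finite I" "I \<subseteq> range coset_rep" and sum: "(\<Sum>w\<in>I. scaleS (c w) (\<pi> w u)) = 0"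
    and w: "w \<in> I"
  shows "c w = 0"
proof -
  have "scaleS (c w) (\<pi> w u) = 0"
  proof (rule S.sum_simultaneous_eigenvectors_eq_0[OF I(1) _ _ _ sum w])
    show "Vector_Spaces.linear scaleS scaleS (\<pi> l)" for l
      by (rule weyl_systemD(1)[OF \<pi>])
    show "\<pi> l (scaleS (c w) (\<pi> w u)) = scaleS (\<psi> (form l w) * \<theta> l) (scaleS (c w) (\<pi> w u))"
      if "l \<in> L" for l w
      by (simp add: weyl_systemD(4)[OF \<pi>] translate_eigen[OF \<pi> u that] mult.commute)
    show "\<exists>l\<in>L. \<psi> (form l x) * \<theta> l \<noteq> \<psi> (form l y) * \<theta> l" if "x \<in> I" "y \<in> I" "x \<noteq> y" for x y
    proof -
      have "x \<in> range coset_rep" "y \<in> range coset_rep" using that I(2) by blast+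
      from separating_lattice_element[OF this that(3)] show ?thesis by blast
    qed
  qed
  then show ?thesis
    using weyl_systemD(9)[OF \<pi>] u by (simp add: lattice_vector_def)
qed

text \<open>Two equal translates would satisfy the relation with coefficients 1 and -1. Injectivity
  lets sums over representatives be exchanged for sums over translates.\<close>

lemma inj_on_coset_rep_translates:
  assumes \<pi>: "weyl_system \<pi>" and u: "lattice_vector \<pi> u"
  shows "inj_on (\<lambda>w. \<pi> w u) (range coset_rep)"
proof (rule inj_onI, rule ccontr)
  fix x y assume xy: "x \<in> range coset_rep" "y \<in> range coset_rep" "\<pi> x u = \<pi> y u" "x \<noteq> y"
  have sum: "(\<Sum>w\<in>{x, y}. scaleS (if w = x then 1 else - 1) (\<pi> w u)) = 0"
    using xy by simp
  then show False
    using coset_rep_translates_independent[OF \<pi> u _ _ sum, of x] xy by simp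
qed

text \<open>With \<open>w = r + l\<close>, where r represents w, the element l acts on u through
  \<open>\<theta>\<close>, and the rest is the cocycle of r and l. The resulting scalar involves
  neither \<open>\<pi>\<close> nor u.\<close>

lemma translate_coset_rep:
  assumes \<pi>: "weyl_system \<pi>" and u: "lattice_vector \<pi> u"
  shows "\<pi> w u = scaleS (\<theta> (w - coset_rep w) / \<psi> (form (coset_rep w) w / 2)) (\<pi> (coset_rep w) u)"
proof -
  let ?r = "coset_rep w" and ?l = "w - coset_rep w"
  have "scaleS (\<theta> ?l) (\<pi> ?r u) = \<pi> ?r (\<pi> ?l u)"
    using u coset_rep[of w] by (simp add: lattice_vector_def weyl_systemD(4)[OF \<pi>])
  also have "\<dots> = scaleS (\<psi> (form ?r w / 2)) (\<pi> w u)"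
    by (simp add: weyl_systemD(2)[OF \<pi>])
  finally have "scaleS (inverse (\<psi> (form ?r w / 2))) (scaleS (\<theta> ?l) (\<pi> ?r u)) = \<pi> w u"
    using psi_nonzero by simp
  then show ?thesis
    by (simp only: S.scale_scale divide_inverse mult.commute)
qed

text \<open>M is prescribed on the independent translates by representatives. The formula extends to
  all w because both systems have the same scalars in \<open>translate_coset_rep\<close>.\<close>

lemma orbit_map:
  assumes \<pi>: "weyl_system \<pi>" "lattice_vector \<pi> u" and \<pi>': "weyl_system \<pi>'" "lattice_vector \<pi>' u'"
  obtains M where "Vector_Spaces.linear scaleS scaleS M" "\<And>w. M (\<pi> w u) = \<pi>' w u'"
proof -
  let ?T = "range coset_rep" and ?t = "\<lambda>w. \<pi> w u"
  have "S.independent (?t ` ?T)"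
    unfolding S.independent_explicit_finite_subsets
  proof (intro allI impI ballI)
    fix B c b assume B: "B \<subseteq> ?t ` ?T" "finite B" "(\<Sum>v\<in>B. scaleS (c v) v) = 0" "b \<in> B"
    obtain I where I: "I \<subseteq> ?T" "finite I" "B = ?t ` I"
      using finite_subset_image[OF B(2,1)] by blast
    have "inj_on ?t I"
      using inj_on_coset_rep_translates[OF \<pi>] I(1) inj_on_subset by blast
    then have sum: "(\<Sum>w\<in>I. scaleS (c (?t w)) (?t w)) = 0"
      using B(3) I(3) by (simp add: sum.reindex)
    obtain w where "w \<in> I" "b = ?t w"
      using B(4) I(3) by blast
    with coset_rep_translates_independent[OF \<pi> I(2,1) sum, of w] show "c b = 0"
      by simp
  qed
  then obtain M where M: "Vector_Spaces.linear scaleS scaleS M"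
    "\<And>b. b \<in> ?t ` ?T \<Longrightarrow> M b = \<pi>' (inv_into ?T ?t b) u'"
    using SS.linear_independent_extend[of "?t ` ?T" "\<lambda>b. \<pi>' (inv_into ?T ?t b) u'"] by blast
  interpret M: Vector_Spaces.linear scaleS scaleS M by (rule M(1))
  have rep: "M (\<pi> w u) = \<pi>' w u'" if "w \<in> ?T" for w
    using M(2)[of "\<pi> w u"] inv_into_f_f[OF inj_on_coset_rep_translates[OF \<pi>] that] that by simp
  have "M (\<pi> w u) = \<pi>' w u'" for w
    unfolding translate_coset_rep[OF \<pi>, of w] translate_coset_rep[OF \<pi>', of w]
    by (simp add: M.scale rep)
  with M(1) show ?thesis by (rule that)
qed

text \<open>The orbit maps in the two directions are mutually inverse on the orbits, which span by
  irreducibility; the intertwining relation is likewise checked on the orbit of u.\<close>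

lemma exists_intertwiner:
  assumes irr: "irreducible_system \<pi>" "lattice_vector \<pi> u"
    and irr': "irreducible_system \<pi>'" "lattice_vector \<pi>' u'"
  obtains M where "Vector_Spaces.linear scaleS scaleS M" "bij M" "M u = u'"
    "\<And>w s. M (\<pi> w s) = \<pi>' w (M s)"
proof -
  note \<pi> = weyl_systemD[OF irreducible_systemD[OF irr(1)]]
  note \<pi>' = weyl_systemD[OF irreducible_systemD[OF irr'(1)]]
  have u: "u \<noteq> 0" "u' \<noteq> 0" using irr(2) irr'(2) by (simp_all add: lattice_vector_def)
  note span = span_orbit[OF irr(1) u(1)] span_orbit[OF irr'(1) u(2)]
  obtain M where M: "Vector_Spaces.linear scaleS scaleS M" "\<And>w. M (\<pi> w u) = \<pi>' w u'"
    using orbit_map[OF irreducible_systemD[OF irr(1)] irr(2) irreducible_systemD[OF irr'(1)] irr'(2)]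
    by blast
  obtain M' where M': "Vector_Spaces.linear scaleS scaleS M'" "\<And>w. M' (\<pi>' w u') = \<pi> w u"
    using orbit_map[OF irreducible_systemD[OF irr'(1)] irr'(2) irreducible_systemD[OF irr(1)] irr(2)]
    by blast
  interpret M: Vector_Spaces.linear scaleS scaleS M by (rule M(1))
  have eqI: "f s = g s" if "S.span (range h) = UNIV" "Vector_Spaces.linear scaleS scaleS f"
    "Vector_Spaces.linear scaleS scaleS g" "\<And>w. f (h w) = g (h w)" for f g s and h :: "'w \<Rightarrow> 's"
    using SS.linear_eq_on[OF that(2,3), of s "range h"] that(1,4) by auto
  have "(M' \<circ> M) s = id s" for s
    by (rule eqI[OF span(1) Vector_Spaces.linear_compose[OF M(1) M'(1)] S.linear_id]) (simp add: M M')
  moreover have "(M \<circ> M') s = id s" for s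
    by (rule eqI[OF span(2) Vector_Spaces.linear_compose[OF M'(1) M(1)] S.linear_id]) (simp add: M M')
  ultimately have "bij M"
    by (intro o_bij[of M' M] ext) blast+
  moreover have "M u = u'"
    using M(2)[of 0] \<pi>(3) \<pi>'(3) by simp
  moreover have "(M \<circ> \<pi> w) s = (\<pi>' w \<circ> M) s" for w s
    by (rule eqI[OF span(1) Vector_Spaces.linear_compose[OF \<pi>(1) M(1)] Vector_Spaces.linear_compose[OF M(1) \<pi>'(1)]])
      (simp add: \<pi>(2) \<pi>'(2) M M.scale)
  ultimately show ?thesis
    using that[OF M(1)] by simp
qed

text \<open>Among the translates by representatives, only that of the representative of 0 has the
  character \<open>\<theta>\<close>, so no other term survives in the expansion of s. This is the
  form in which Schur's lemma is used.\<close>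

lemma lattice_vector_unique:
  assumes irr: "irreducible_system \<pi>" and u: "lattice_vector \<pi> u" and s: "lattice_vector \<pi> s"
  obtains c where "s = scaleS c u"
proof -
  note sys = irreducible_systemD[OF irr]
  note \<pi> = weyl_systemD[OF sys]
  let ?T = "range coset_rep" and ?t = "\<lambda>w. \<pi> w u"
  have "?t w \<in> S.span (?t ` ?T)" for w
    by (subst translate_coset_rep[OF sys u]) (intro S.span_scale S.span_base imageI rangeI)
  then have "S.span (range ?t) \<subseteq> S.span (?t ` ?T)"
    by (intro S.span_minimal image_subsetI S.subspace_span)
  then have "s \<in> S.span (?t ` ?T)"
    using span_orbit[OF irr] u by (auto simp: lattice_vector_def)
  then obtain B a where B: "finite B" "B \<subseteq> ?t ` ?T" "s = (\<Sum>b\<in>B. scaleS (a b) b)"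
    unfolding S.span_explicit by blast
  obtain I where I: "I \<subseteq> ?T" "finite I" "B = ?t ` I"
    using finite_subset_image[OF B(1,2)] by blast
  have "inj_on ?t I"
    using inj_on_coset_rep_translates[OF sys u] I(1) inj_on_subset by blast
  then have s_eq: "s = (\<Sum>w\<in>I. scaleS (a (?t w)) (?t w))"
    using B(3) I(3) by (simp add: sum.reindex)
  define r where "r = coset_rep 0"
  \<comment> \<open>Extended by 0, because r need not occur in I.\<close>
  define c where "c = (\<lambda>w. if w \<in> I then a (?t w) else 0)"
  have r: "r \<in> L" using coset_rep(1)[of 0] by (simp add: r_def)
  \<comment> \<open>Subtracting s from the term of r, with which it shares its character, makes the
    expansion a relation between eigenvectors with distinct characters.\<close>
  define x where "x = (\<lambda>w. scaleS (c w) (?t w) - (if w = r then s else 0))"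
  have "(\<Sum>w\<in>insert r I. scaleS (c w) (?t w)) = s"
    unfolding s_eq by (rule sum.mono_neutral_cong_right) (auto simp: c_def I)
  then have sum: "sum x (insert r I) = 0"
    using I(2) by (simp add: x_def sum_subtractf del: sum.insert)
  have "x r = 0"
  proof (rule S.sum_simultaneous_eigenvectors_eq_0[OF _ _ _ _ sum])
    show "Vector_Spaces.linear scaleS scaleS (\<pi> l)" for l by (rule \<pi>(1))
    show "\<pi> l (x w) = scaleS (\<psi> (form l w) * \<theta> l) (x w)" if "l \<in> L" for l w
    proof -
      interpret l: Vector_Spaces.linear scaleS scaleS "\<pi> l" by (rule \<pi>(1))
      have "\<pi> l s = scaleS (\<psi> (form l r) * \<theta> l) s"
        using s that r by (simp add: lattice_vector_def L_isotropic)
      then show ?thesis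
        by (simp add: x_def l.diff l.scale l.zero translate_eigen[OF sys u that]
            S.scale_right_diff_distrib mult.commute)
    qed
    show "\<exists>l\<in>L. \<psi> (form l v) * \<theta> l \<noteq> \<psi> (form l w) * \<theta> l"
      if "v \<in> insert r I" "w \<in> insert r I" "v \<noteq> w" for v w
    proof -
      have "v \<in> range coset_rep" "w \<in> range coset_rep" using that I(1) by (auto simp: r_def)
      from separating_lattice_element[OF this that(3)] show ?thesis by blast
    qed
  qed (use I in auto)
  then have "s = scaleS (c r * \<theta> r) u"
    using u r by (simp add: x_def lattice_vector_def)
  then show ?thesis by (rule that)
qed

section \<open>Existence of lattice vectors by enlarging sublattices\<close>

lemma lattice_stabilizer_subgroup:
  assumes \<pi>: "weyl_system \<pi>"
  shows "add_subgroup {l \<in> L. \<pi> l v = scaleS (\<theta> l) v}" (is "add_subgroup ?Q")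
proof -
  note L = add_subgroupD[OF L_subgroup]
  have add: "a + b \<in> ?Q" if "a \<in> ?Q" "b \<in> ?Q" for a b
  proof -
    have "scaleS (\<psi> (form a b / 2)) (\<pi> (a + b) v) = scaleS (\<theta> a * \<theta> b) v"
      using that weyl_systemD(2)[OF \<pi>, of a b v] by (simp add: weyl_systemD(4)[OF \<pi>] mult.commute)
    also have "\<dots> = scaleS (\<psi> (form a b / 2)) (scaleS (\<theta> (a + b)) v)"
      using that theta_add[of a b] by simp
    finally have "\<pi> (a + b) v = scaleS (\<theta> (a + b)) v"
      by (rule S.scale_left_imp_eq[OF psi_nonzero])
    then show ?thesis using that L by simp
  qed
  have minus: "- a \<in> ?Q" if "a \<in> ?Q" for a
  proof -
    have "scaleS (\<theta> a) (\<pi> (- a) v) = v"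
      using that weyl_systemD(8)[OF \<pi>, of a v] by (simp add: weyl_systemD(4)[OF \<pi>])
    then have "scaleS (\<theta> (- a)) (scaleS (\<theta> a) (\<pi> (- a) v)) = scaleS (\<theta> (- a)) v"
      by simp
    moreover have "\<theta> (- a) * \<theta> a = 1"
      using theta_add[of "- a" a] that L by (simp add: psi_simps theta_zero)
    ultimately show ?thesis using that L by simp
  qed
  have "0 \<in> ?Q"
    using L weyl_systemD(3)[OF \<pi>] by (simp add: theta_zero)
  moreover have "a - b \<in> ?Q" if "a \<in> ?Q" "b \<in> ?Q" for a b
    using add[OF that(1) minus[OF that(2)]] by simp
  ultimately show ?thesis
    unfolding add_subgroup_def by blast
qed

text \<open>On \<open>v\<close> the operator \<open>T = \<theta>(x)\<^sup>-\<^sup>1 \<pi>(x)\<close> has order \<open>p\<close>, so it has an eigenvector.  As \<open>x \<notin> N\<close>,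
  some \<open>y\<close> orthogonal to \<open>N\<close> shifts its eigenvalues by a primitive \<open>p\<close>-th root of unity.\<close>
lemma extend_sublattice:
  assumes \<pi>: "weyl_system \<pi>" and p: "prime p" "(of_nat p :: 'r) \<noteq> 0"
    and N: "add_subgroup N" "N \<subseteq> L" "perp_closed N"
    and v: "v \<noteq> 0" "\<And>n. n \<in> N \<Longrightarrow> \<pi> n v = scaleS (\<theta> n) v"
    and x: "x \<in> L" "x \<notin> N" "scaleW (of_nat p) x \<in> N"
  obtains N' v' where "add_subgroup N'" "N \<subseteq> N'" "x \<in> N'" "N' \<subseteq> L" "perp_closed N'"
    "v' \<noteq> 0" "\<And>n. n \<in> N' \<Longrightarrow> \<pi> n v' = scaleS (\<theta> n) v'"
proof -
  note \<pi>D = weyl_systemD[OF \<pi>]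
  obtain y where y: "y \<in> perp N" "\<psi> (form x y) \<noteq> 1"
    using N(3) x(2) unfolding perp_closed_def by blast
  define \<zeta> where "\<zeta> = \<psi> (form x y)"
  \<comment> \<open>The power is \<open>\<psi> (form (scaleW (of_nat p) x) y')\<close>, and p times
    x lies in N.\<close>
  have root: "\<psi> (form x y') ^ p = 1" if "y' \<in> perp N" for y'
    using that x(3) by (auto simp: perp_def simp flip: psi_simps)
  have \<zeta>: "\<zeta> ^ p = 1" "\<zeta> \<noteq> 1"
    using root[OF y(1)] y(2) by (simp_all add: \<zeta>_def)
  define T where "T = (\<lambda>s. scaleS (inverse (\<theta> x)) (\<pi> x s))"
  have lin: "Vector_Spaces.linear scaleS scaleS T"
    unfolding T_def by (rule SS.linear_compose_scale_right[OF \<pi>D(1)])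
  have theta_x: "\<theta> x \<noteq> 0" using theta_nonzero x(1) by blast
  have Tk: "(T ^^ k) v = scaleS (inverse (\<theta> x ^ k)) (\<pi> (scaleW (of_nat k) x) v)" for k
  proof (induction k)
    case (Suc k)
    then show ?case
      by (simp add: T_def \<pi>D(2,4) psi_simps W.scale_left_distrib mult.commute)
  qed (simp add: \<pi>D)
  have Tp: "(T ^^ p) v = v"
    unfolding Tk using v(2)[OF x(3)] theta_x by (simp add: theta_scale_of_nat[OF x(1)])
  obtain j s where s: "s \<noteq> 0" "scaleS (\<zeta> ^ j) (T s) = s"
    "s = (\<Sum>k<p. scaleS (\<zeta> ^ (j * k)) ((T ^^ k) v))"
    by (rule S.prime_order_eigenvector[OF p \<zeta> lin Tp v(1)])
  have s_N: "\<pi> n s = scaleS (\<theta> n) s" if n: "n \<in> N" for n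
  proof -
    have "\<pi> n ((T ^^ k) v) = scaleS (\<theta> n) ((T ^^ k) v)" for k
    proof -
      have "\<pi> n (\<pi> (scaleW (of_nat k) x) v) = \<pi> (scaleW (of_nat k) x) (\<pi> n v)"
        using n N(2) L_isotropic[OF _ subgroup_scale_of_nat[OF L_subgroup x(1)], of n k]
        by (subst \<pi>D(7)) auto
      then show ?thesis
        by (simp add: Tk \<pi>D(4) v(2)[OF n] mult.commute)
    qed
    then show ?thesis
      unfolding s(3) by (simp add: \<pi>D(4,6) S.scale_sum_right mult.commute)
  qed
  \<comment> \<open>T has eigenvalue \<open>inverse (\<zeta> ^ j)\<close> on s. Translating by j
    times y multiplies it by \<open>\<zeta> ^ j\<close> and leaves the action of N alone, as y is
    orthogonal to N.\<close>
  define v' where "v' = \<pi> (scaleW (of_nat j) y) s"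
  have v'0: "v' \<noteq> 0"
    using s(1) \<pi>D(9) by (simp add: v'_def)
  have v'_N: "\<pi> n v' = scaleS (\<theta> n) v'" if n: "n \<in> N" for n
  proof -
    have "\<psi> (form n (scaleW (of_nat j) y)) = 1"
      using y(1) n by (simp add: perp_def psi_simps)
    then show ?thesis
      unfolding v'_def by (subst \<pi>D(7)) (simp add: s_N[OF n] \<pi>D(4))
  qed
  have "\<pi> x v' = scaleS (\<theta> x) v'"
  proof -
    have "\<pi> x v' = scaleS (\<zeta> ^ j) (\<pi> (scaleW (of_nat j) y) (\<pi> x s))"
      unfolding v'_def by (subst \<pi>D(7)) (simp add: \<zeta>_def psi_simps)
    also have "\<pi> x s = scaleS (\<theta> x) (T s)"
      using theta_x by (simp add: T_def)
    also have "scaleS (\<zeta> ^ j) (\<pi> (scaleW (of_nat j) y) (scaleS (\<theta> x) (T s)))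
        = scaleS (\<theta> x) (\<pi> (scaleW (of_nat j) y) (scaleS (\<zeta> ^ j) (T s)))"
      by (simp add: \<pi>D(4) mult.commute)
    also have "\<dots> = scaleS (\<theta> x) v'"
      by (simp only: s(2) v'_def)
    finally show ?thesis .
  qed
  define N' where "N' = {n + scaleW (of_int m) x | n m. n \<in> N}"
  have mem: "n + scaleW (of_int m) x \<in> N'" if "n \<in> N" for n m
    using that by (auto simp: N'_def)
  have N'_subgroup: "add_subgroup N'"
    unfolding add_subgroup_def
  proof (intro conjI ballI)
    show "0 \<in> N'" using mem[of 0 0] add_subgroupD(1)[OF N(1)] by simp
    fix a b assume "a \<in> N'" "b \<in> N'"
    then obtain n m n' m' where *: "n \<in> N" "n' \<in> N"
      "a = n + scaleW (of_int m) x" "b = n' + scaleW (of_int m') x"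
      by (auto simp: N'_def)
    then have "a - b = (n - n') + scaleW (of_int (m - m')) x"
      by (simp add: W.scale_left_diff_distrib)
    then show "a - b \<in> N'"
      using mem[of "n - n'"] add_subgroupD(4)[OF N(1)] * by metis
  qed
  have N_N': "N \<subseteq> N'"
    using mem[of _ 0] by auto
  have x_N': "x \<in> N'"
    using mem[of 0 1] add_subgroupD(1)[OF N(1)] by simp
  have sub: "N' \<subseteq> {l \<in> L. \<pi> l v' = scaleS (\<theta> l) v'}"
  proof -
    \<comment> \<open>The elements of L acting on \<open>v'\<close> through \<open>\<theta>\<close>
      form a subgroup, so checking N and x settles all of \<open>N'\<close>.\<close>
    note Q = lattice_stabilizer_subgroup[OF \<pi>, of v']
    have "x \<in> {l \<in> L. \<pi> l v' = scaleS (\<theta> l) v'}" "N \<subseteq> {l \<in> L. \<pi> l v' = scaleS (\<theta> l) v'}"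
      using x(1) N(2) v'_N \<open>\<pi> x v' = _\<close> by auto
    then show ?thesis
      using add_subgroupD(3)[OF Q] subgroup_scale_of_int[OF Q] unfolding N'_def by blast
  qed
  \<comment> \<open>Modulo multiples of y every element of \<open>perp N\<close> lies in
    \<open>perp N'\<close>. If z is orthogonal to \<open>perp N'\<close>, adding a multiple of x
    makes it orthogonal to y as well, hence to \<open>perp N\<close>, and so moves it into
    N.\<close>
  have closed: "perp_closed N'"
    unfolding perp_closed_def
  proof (intro allI impI)
    fix z assume z: "\<forall>y\<in>perp N'. \<psi> (form z y) = 1"
    have perp': "y' \<in> perp N'" if y': "y' \<in> perp N" "\<psi> (form x y') = 1" for y'
    proof -
      have "add_subgroup {a. \<psi> (form a y') = 1}"
        by (auto simp: add_subgroup_def psi_simps)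
      from subgroup_scale_of_int[OF this] show ?thesis
        using y' by (auto simp: perp_def N'_def psi_add)
    qed
    have add_perp: "y' + scaleW (of_nat i) y \<in> perp N" if "y' \<in> perp N" for y' i
      using that y(1) by (auto simp: perp_def psi_add psi_simps)
    have "scaleW (of_nat p) y \<in> perp N'"
      using y(1) root[OF y(1)] by (intro perp') (auto simp: perp_def psi_simps)
    then have "\<psi> (form z y) ^ p = 1"
      using z by (auto simp flip: psi_simps)
    then obtain i where i: "\<zeta> ^ i * \<psi> (form z y) = 1"
      using prime_root_of_unity_eq_power[OF p \<zeta>] by blast
    define z' where "z' = z + scaleW (of_nat i) x"
    have z'y: "\<psi> (form z' y) = 1"
      using i by (simp add: z'_def psi_add psi_simps \<zeta>_def mult.commute)
    have "\<psi> (form z' y') = 1" if y': "y' \<in> perp N" for y'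
    proof -
      obtain i' where i': "\<zeta> ^ i' * \<psi> (form x y') = 1"
        using prime_root_of_unity_eq_power[OF p \<zeta> root[OF y']] by blast
      let ?y = "y' + scaleW (of_nat i') y"
      have xy: "\<psi> (form x ?y) = 1"
        using i' by (simp add: psi_add psi_simps \<zeta>_def mult.commute)
      have "\<psi> (form z ?y) = 1"
        using perp'[OF add_perp[OF y'] xy] z by blast
      then have "\<psi> (form z' ?y) = 1"
        using xy by (simp add: z'_def psi_add psi_simps del: W.form_simps(2))
      then show ?thesis
        using z'y by (simp add: psi_add psi_simps)
    qed
    then have "z' \<in> N"
      using N(3) unfolding perp_closed_def by blast
    then have "z' + scaleW (of_int (- int i)) x \<in> N'"
      by (rule mem)
    then show "z \<in> N'"
      by (simp add: z'_def W.scale_minus_left)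
  qed
  show ?thesis
  proof (rule that[OF N'_subgroup N_N' x_N' _ closed v'0])
    show "N' \<subseteq> L" using sub by blast
    show "\<pi> n v' = scaleS (\<theta> n) v'" if "n \<in> N'" for n using sub that by blast
  qed
qed

text \<open>X meets every coset of N in L, so \<open>card (X \<inter> K)\<close> measures the
  sublattices K between N and L, and a K with an eigenvector can be chosen maximal. If K is not L,
  some multiple x of a vector of L lies outside K with p times x inside, and
  \<open>extend_sublattice\<close> applies.\<close>

lemma exists_lattice_vector:
  assumes \<pi>: "weyl_system \<pi>" and p: "prime p" "(of_nat p :: 'r) \<noteq> 0"
    and N: "add_subgroup N" "N \<subseteq> L" "perp_closed N" "\<And>l. l \<in> L \<Longrightarrow> scaleW (of_nat (p ^ k)) l \<in> N"
    and X: "finite X" "\<And>l. l \<in> L \<Longrightarrow> \<exists>a\<in>X. l - a \<in> N"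
    and v: "v \<noteq> 0" "\<And>n. n \<in> N \<Longrightarrow> \<pi> n v = scaleS (\<theta> n) v"
  obtains u where "lattice_vector \<pi> u"
proof -
  define P where "P = (\<lambda>K. add_subgroup K \<and> N \<subseteq> K \<and> K \<subseteq> L \<and> perp_closed K \<and>
    (\<exists>v. v \<noteq> 0 \<and> (\<forall>n\<in>K. \<pi> n v = scaleS (\<theta> n) v)))"
  have "P N" using N v unfolding P_def by blast
  moreover have "\<forall>K. P K \<longrightarrow> card (X \<inter> K) < Suc (card X)"
    using X(1) by (simp add: card_mono less_Suc_eq_le)
  ultimately obtain K where K: "P K" "\<And>K'. P K' \<Longrightarrow> card (X \<inter> K') \<le> card (X \<inter> K)"
    using ex_has_greatest_nat[of P N "\<lambda>K. card (X \<inter> K)" "Suc (card X)"] by blast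
  note sub = K(1)[unfolded P_def]
  then have Ksub: "add_subgroup K" by blast
  have "L \<subseteq> K"
  proof (rule ccontr)
    assume "\<not> L \<subseteq> K"
    then obtain l where l: "l \<in> L" "l \<notin> K" by blast
    have "scaleW (of_nat (p ^ k)) l \<in> K"
      using N(4)[OF l(1)] sub by blast
    moreover have "scaleW (of_nat (p ^ 0)) l \<notin> K" using l by simp
    ultimately obtain j where j: "scaleW (of_nat (p ^ j)) l \<notin> K" "scaleW (of_nat (p ^ Suc j)) l \<in> K"
      using nat_induct[of "\<lambda>j. scaleW (of_nat (p ^ j)) l \<notin> K"] by blast
    define x where "x = scaleW (of_nat (p ^ j)) l"
    have x: "x \<in> L" "x \<notin> K" "scaleW (of_nat p) x \<in> K"
      using j subgroup_scale_of_nat[OF L_subgroup l(1), of "p ^ j"] by (auto simp: x_def)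
    obtain v' where v': "v' \<noteq> 0" "\<And>n. n \<in> K \<Longrightarrow> \<pi> n v' = scaleS (\<theta> n) v'"
      using sub by blast
    obtain K' w where K': "add_subgroup K'" "K \<subseteq> K'" "x \<in> K'" "K' \<subseteq> L" "perp_closed K'"
      "w \<noteq> 0" "\<And>n. n \<in> K' \<Longrightarrow> \<pi> n w = scaleS (\<theta> n) w"
      using extend_sublattice[OF \<pi> p Ksub _ _ v' x] sub by blast
    then have "P K'" using sub unfolding P_def by blast
    \<comment> \<open>As N lies in both lattices, the representative a of x counts for
      \<open>K'\<close> but not for K.\<close>
    obtain a where a: "a \<in> X" "x - a \<in> N" using X(2) x(1) by blast
    have "x - a \<in> K" "x - a \<in> K'" using a sub K'(2) by auto
    then have "a \<in> K'" "a \<notin> K"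
      using add_subgroupD(4)[OF K'(1) K'(3), of "x - a"] add_subgroupD(3)[OF Ksub, of "x - a" a] x(2) by auto
    then have "card (X \<inter> K) < card (X \<inter> K')"
      using a(1) K'(2) X(1) by (intro psubset_card_mono) auto
    then show False using K(2)[OF \<open>P K'\<close>] by simp
  qed
  then show ?thesis
    using that sub unfolding lattice_vector_def by blast
qed

end

section \<open>The metaplectic group\<close>

locale polarized_setting =
  metaplectic_setting p TF scaleW Basis form \<psi> scaleS \<rho> + dual_lattices TF \<psi> p A D
  for p :: nat and TF :: "'f::field topology"
    and scaleW :: "'f \<Rightarrow> 'w::ab_group_add \<Rightarrow> 'w" and Basis form
    and \<psi> :: "'f \<Rightarrow> 'r::field"
    and scaleS :: "'r \<Rightarrow> 's::ab_group_add \<Rightarrow> 's" and \<rho> and A D :: "'f set" +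
  fixes n :: nat and e f :: "nat \<Rightarrow> 'w"
  assumes family: "W.symplectic_family n e f"
    and expand: "w = (\<Sum>i<n. scaleW (form w (f i)) (e i) + scaleW (form (e i) w) (f i))"
begin

lemmas psi_simps = character_simps[of \<psi>, OF psi_nonzero psi_add]
lemmas pairing = W.symplectic_familyD[OF family]

section \<open>Coordinates in the symplectic basis and the self-dual lattice\<close>

lemma form_coordinates:
  "form w w' = (\<Sum>i<n. form w (f i) * form (e i) w' - form (e i) w * form w' (f i))"
proof -
  have "form w w' = (\<Sum>i<n. form w' (f i) * form w (e i) + form (e i) w' * form w (f i))"
    by (subst expand[of w']) (simp add: W.form_sum)
  also have "\<dots> = (\<Sum>i<n. form w (f i) * form (e i) w' - form (e i) w * form w' (f i))"
    using W.form_commute[of w] by (intro sum.cong) (auto simp: algebra_simps)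
  finally show ?thesis .
qed

definition combination :: "(nat \<Rightarrow> 'f) \<Rightarrow> (nat \<Rightarrow> 'f) \<Rightarrow> 'w" where
  "combination a b = (\<Sum>i<n. scaleW (a i) (e i) + scaleW (b i) (f i))"

lemma form_combination:
  assumes "j < n"
  shows "form (combination a b) (f j) = a j" "form (e j) (combination a b) = b j"
proof -
  have "form (combination a b) (f j) = (\<Sum>i<n. if i = j then a i else 0)"
    unfolding combination_def W.form_sum using pairing assms by (intro sum.cong) auto
  then show "form (combination a b) (f j) = a j" using assms by simp
  have "form (e j) (combination a b) = (\<Sum>i<n. if i = j then b i else 0)"
    unfolding combination_def W.form_sum using pairing assms by (intro sum.cong) auto
  then show "form (e j) (combination a b) = b j" using assms by simp
qed

text \<open>\<open>form w (f i)\<close> is the coordinate of w along \<open>e i\<close>, and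
  \<open>form (e i) w\<close> the one along \<open>f i\<close>.\<close>

definition box :: "'f set \<Rightarrow> 'f set \<Rightarrow> 'w set" where
  "box B C = {w. \<forall>i<n. form w (f i) \<in> B \<and> form (e i) w \<in> C}"

definition L :: "'w set" where
  "L = box A D"

text \<open>In residual characteristic 2 the cocycle \<open>\<psi> (form l l' / 2)\<close> may be nontrivial on \<open>L\<close>; it is
  then the coboundary of this quadratic function.\<close>
definition \<theta> :: "'w \<Rightarrow> 'r" where
  "\<theta> w = \<psi> ((\<Sum>i<n. form w (f i) * form (e i) w) / 2)"

lemma box_subgroup: "add_subgroup B \<Longrightarrow> add_subgroup C \<Longrightarrow> add_subgroup (box B C)"
  by (simp add: add_subgroup_def box_def)

text \<open>Multiples of a single \<open>e i\<close> or \<open>f i\<close> lie in the box, because 0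
  is allowed in the other coordinates; they test one coordinate of z at a time.\<close>

lemma perp_box:
  assumes "\<And>w. w \<in> box B C \<Longrightarrow> \<psi> (form w z) = 1" "add_subgroup B" "add_subgroup C" "i < n"
  shows "b \<in> B \<Longrightarrow> \<psi> (b * form (e i) z) = 1" "c \<in> C \<Longrightarrow> \<psi> (c * form z (f i)) = 1"
proof -
  note zero = add_subgroupD(1)[OF assms(2)] add_subgroupD(1)[OF assms(3)]
  show "\<psi> (b * form (e i) z) = 1" if "b \<in> B"
    using assms(1)[of "scaleW b (e i)"] pairing[of _ i] pairing[of i] that zero assms(4)
    by (auto simp: box_def)
  have "\<psi> (c * form (f i) z) = 1" if "c \<in> C"
    using assms(1)[of "scaleW c (f i)"] pairing[of _ i] pairing[of i] that zero assms(4)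
    by (auto simp: box_def)
  then show "\<psi> (c * form z (f i)) = 1" if "c \<in> C"
    using that W.form_commute[of "f i" z] by (simp add: psi_simps)
qed

lemma psi_sum_eq_1: "(\<And>i. i \<in> I \<Longrightarrow> \<psi> (h i) = 1) \<Longrightarrow> \<psi> (sum h I) = 1"
  by (simp add: psi_simps)

lemma L_isotropic:
  assumes "l \<in> L" "l' \<in> L"
  shows "\<psi> (form l l') = 1"
  unfolding form_coordinates[of l l']
proof (rule psi_sum_eq_1)
  fix i assume "i \<in> {..<n}"
  then have "\<psi> (form l (f i) * form (e i) l') = 1" "\<psi> (form l' (f i) * form (e i) l) = 1"
    using assms psi_A_D by (auto simp: L_def box_def)
  then show "\<psi> (form l (f i) * form (e i) l' - form (e i) l * form l' (f i)) = 1"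
    by (simp add: psi_simps mult.commute)
qed

sublocale weyl: weyl_lattice scaleW Basis form scaleS \<psi> L \<theta>
proof
  show "add_subgroup L"
    unfolding L_def by (intro box_subgroup A_subgroup D_subgroup)
  show "w \<in> L \<longleftrightarrow> (\<forall>l\<in>L. \<psi> (form l w) = 1)" for w
  proof
    assume w: "\<forall>l\<in>L. \<psi> (form l w) = 1"
    have "form w (f i) \<in> A \<and> form (e i) w \<in> D" if "i < n" for i
      using perp_box[of A D w i] w that A_subgroup D_subgroup
      unfolding A_perp[of "form w (f i)"] D_perp[of "form (e i) w"] L_def by (metis mult.commute)
    then show "w \<in> L" by (simp add: L_def box_def)
  qed (use L_isotropic in blast)
  show "\<theta> l * \<theta> l' = \<psi> (form l l' / 2) * \<theta> (l + l')" if "l \<in> L" "l' \<in> L" for l l'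
  proof -
    let ?q = "\<lambda>w. \<Sum>i<n. form w (f i) * form (e i) w"
    \<comment> \<open>This sum is the error between the cocycle and the coboundary of
      \<open>\<theta>\<close>; each of its terms pairs A with D.\<close>
    have "\<psi> (\<Sum>i<n. form l (f i) * form (e i) l') = 1"
      using that psi_A_D by (intro psi_sum_eq_1) (auto simp: L_def box_def)
    moreover have "form l l' / 2 + ?q (l + l') / 2
        = ?q l / 2 + ?q l' / 2 + (\<Sum>i<n. form l (f i) * form (e i) l')"
    proof -
      have "form l l' + ?q (l + l') = ?q l + ?q l' + 2 * (\<Sum>i<n. form l (f i) * form (e i) l')"
        unfolding form_coordinates[of l l'] sum_distrib_left sum.distrib[symmetric]
        by (intro sum.cong) (auto simp: algebra_simps)
      then show ?thesis
        using two_nonzero by (simp add: field_simps)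
    qed
    ultimately have "\<psi> (form l l' / 2 + ?q (l + l') / 2) = \<psi> (?q l / 2 + ?q l' / 2)"
      by (simp only: psi_add mult_1_right)
    then show ?thesis
      by (simp only: \<theta>_def psi_add)
  qed
qed (use psi_add psi_nonzero two_nonzero in \<open>auto simp: \<theta>_def\<close>)

section \<open>Twists of the Heisenberg representation by the symplectic group\<close>

lemma rho_linear: "Vector_Spaces.linear scaleS scaleS (\<rho> h)"
  using rep_GL by (simp add: GL_def)

lemma rho_simps:
  "\<rho> h (scaleS c s) = scaleS c (\<rho> h s)" "\<rho> h (s + s') = \<rho> h s + \<rho> h s'" "\<rho> h 0 = 0"
proof -
  interpret l: Vector_Spaces.linear scaleS scaleS "\<rho> h" by (rule rho_linear)
  show "\<rho> h (scaleS c s) = scaleS c (\<rho> h s)" "\<rho> h (s + s') = \<rho> h s + \<rho> h s'" "\<rho> h 0 = 0"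
    by (fact l.scale l.add l.zero)+
qed

lemma rho_mult: "\<rho> (w, t) (\<rho> (w', t') s) = \<rho> (w + w', t + t' + form w w' / 2) s"
  using rep_mult[of "(w, t)" "(w', t')"] by (simp add: W.heis_mult_def fun_eq_iff)

lemma rho_center: "\<rho> (w, t) s = scaleS (\<psi> t) (\<rho> (w, 0) s)"
  using rho_mult[of 0 t w 0 s] by (simp add: central_character)

text \<open>The conditions on \<open>(g, M)\<close> in \<open>Mp\<close> say that M is a bijective
  intertwiner from \<open>twist g\<close> to \<open>twist id\<close>.\<close>

definition twist :: "('w \<Rightarrow> 'w) \<Rightarrow> 'w \<Rightarrow> 's \<Rightarrow> 's" where
  "twist g w = \<rho> (g w, 0)"

text \<open>g preserves the form, hence the cocycle. It is also onto, and the centre acts by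
  scalars, so both actions have the same invariant subspaces.\<close>

lemma twist_irreducible:
  assumes g: "g \<in> W.Sp"
  shows "weyl.irreducible_system (twist g)"
  unfolding weyl.irreducible_system_def weyl.weyl_system_def
proof (intro conjI allI impI)
  note G = W.SpD[OF g]
  show "Vector_Spaces.linear scaleS scaleS (twist g w)" for w
    unfolding twist_def by (rule rho_linear)
  show "twist g w (twist g w' s) = scaleS (\<psi> (form w w' / 2)) (twist g (w + w') s)" for w w' s
    by (simp add: twist_def rho_mult G(3,4) rho_center[of _ "form w w' / 2"])
  show "twist g 0 s = s" for s
    using G(5)[of 0 0] by (simp add: twist_def central_character psi_simps)
  fix U assume U: "S.subspace U" "\<forall>w. twist g w ` U \<subseteq> U"
  have "\<rho> (w, t) ` U \<subseteq> U" for w t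
  proof
    fix y assume "y \<in> \<rho> (w, t) ` U"
    then obtain s where s: "s \<in> U" "y = \<rho> (w, t) s" by blast
    then have "\<rho> (w, 0) s \<in> U"
      using U(2) G(8)[of w] unfolding twist_def by (metis image_subset_iff)
    then show "y \<in> U"
      using s(2) rho_center[of w t s] S.subspace_scale[OF U(1)] by simp
  qed
  then show "U = {0} \<or> U = UNIV"
    using irreducible[OF U(1)] by (metis surj_pair)
qed

lemmas twist_system = weyl.irreducible_systemD[OF twist_irreducible]

lemma id_Sp: "id \<in> W.Sp"
  using W.linear_id by (simp add: W.Sp_def)

section \<open>Neighbourhoods in W and Sp, and data locally constant in g\<close>

lemma open_subgroup_Int:
  "openin TF B \<and> add_subgroup B \<Longrightarrow> openin TF C \<and> add_subgroup C \<Longrightarrow> openin TF (B \<inter> C) \<and> add_subgroup (B \<inter> C)"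
  by (simp add: openin_Int add_subgroup_Int)

lemma W_neighbourhood:
  assumes U: "openin (W.W_topology TF) U" "0 \<in> U"
  obtains B where "openin TF B" "0 \<in> B" "\<And>w. (\<And>b. b \<in> Basis \<Longrightarrow> W.representation Basis w b \<in> B) \<Longrightarrow> w \<in> U"
proof -
  let ?c = "\<lambda>w. \<lambda>b\<in>Basis. W.representation Basis w b"
  obtain V where V: "openin (product_topology (\<lambda>_. TF) Basis) V" "U = ?c -` V"
    using U(1) by (auto simp: W.W_topology_def openin_pullback_topology)
  have "?c 0 \<in> V" using U(2) V(2) by simp
  with V(1)[unfolded openin_product_topology_alt, rule_format]
  have "\<exists>X. finite {b \<in> Basis. X b \<noteq> topspace TF} \<and> (\<forall>b\<in>Basis. openin TF (X b)) \<and>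
      ?c 0 \<in> Pi\<^sub>E Basis X \<and> Pi\<^sub>E Basis X \<subseteq> V" .
  then obtain X where X: "\<And>b. b \<in> Basis \<Longrightarrow> openin TF (X b)" "?c 0 \<in> Pi\<^sub>E Basis X" "Pi\<^sub>E Basis X \<subseteq> V"
    by auto
  show ?thesis
  proof (rule that)
    have "topspace TF = UNIV" by (rule topspace_finite_or_local_field[OF base_field])
    then have "openin TF UNIV" by (metis openin_topspace)
    \<comment> \<open>\<open>UNIV\<close> keeps the family nonempty when \<open>Basis\<close> is
      empty.\<close>
    then show "openin TF (\<Inter> (insert UNIV (X ` Basis)))"
      using X(1) W.finite_Basis by (intro openin_Inter) auto
    show "0 \<in> \<Inter> (insert UNIV (X ` Basis))"
      using X(2) by (auto simp: W.representation_zero PiE_iff)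
    fix w assume "\<And>b. b \<in> Basis \<Longrightarrow> W.representation Basis w b \<in> \<Inter> (insert UNIV (X ` Basis))"
    then have "?c w \<in> Pi\<^sub>E Basis X" by auto
    then have "?c w \<in> V" using X(3) by blast
    then show "w \<in> U" using V(2) by simp
  qed
qed

text \<open>Translates smoothness from coordinates in \<open>Basis\<close> to symplectic
  coordinates; the coefficients in between are the entries of the images \<open>g (e i)\<close> and
  \<open>g (f i)\<close>.\<close>

lemma smooth_box:
  assumes g: "g \<in> W.Sp"
  obtains B where "openin TF B" "add_subgroup B" "\<And>d. d \<in> box B B \<Longrightarrow> twist g d s = s"
proof -
  note G = W.SpD[OF g]
  have "openin (prod_topology (W.W_topology TF) TF) {h. \<rho> h s = s}"
    using smooth by (simp add: W.heis_topology_def)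
  moreover have "(0, 0) \<in> {h. \<rho> h s = s}"
    by (simp add: central_character psi_simps)
  ultimately obtain U V where U: "openin (W.W_topology TF) U" "0 \<in> U" "0 \<in> V" "U \<times> V \<subseteq> {h. \<rho> h s = s}"
    unfolding openin_prod_topology_alt by blast
  obtain B0 where B0: "openin TF B0" "0 \<in> B0"
    "\<And>w. (\<And>b. b \<in> Basis \<Longrightarrow> W.representation Basis w b \<in> B0) \<Longrightarrow> w \<in> U"
    using W_neighbourhood[OF U(1,2)] by blast
  obtain B1 where B1: "openin TF B1" "add_subgroup B1" "B1 \<subseteq> B0"
    using small_subgroup[OF B0(1,2)] by blast
  let ?r = "W.representation Basis"
  let ?C = "(\<lambda>(i, b). ?r (g (e i)) b) ` ({..<n} \<times> Basis) \<union> (\<lambda>(i, b). ?r (g (f i)) b) ` ({..<n} \<times> Basis)"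
  have fin: "finite ?C" using W.finite_Basis by simp
  obtain B where B: "openin TF B" "add_subgroup B" "\<And>c x. c \<in> ?C \<Longrightarrow> x \<in> B \<Longrightarrow> c * x \<in> B1"
    using small_multiples[OF B1(1) add_subgroupD(1)[OF B1(2)] fin] by blast
  interpret gl: Vector_Spaces.linear scaleW scaleW g by (rule G(1))
  show ?thesis
  proof (rule that[OF B(1,2)])
    fix d assume d: "d \<in> box B B"
    have "g d \<in> U"
    proof (rule B0(3))
      fix b assume b: "b \<in> Basis"
      have "g d = (\<Sum>i<n. scaleW (form d (f i)) (g (e i)) + scaleW (form (e i) d) (g (f i)))"
        by (subst expand[of d]) (simp add: gl.sum gl.add gl.scale)
      then have "?r (g d) b = (\<Sum>i<n. form d (f i) * ?r (g (e i)) b + form (e i) d * ?r (g (f i)) b)"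
        by (simp add: W.representation_sum W.representation_add W.representation_scale
            W.independent_Basis W.span_Basis)
      also have "\<dots> \<in> B1"
      proof (intro add_subgroup_sum[OF B1(2)] add_subgroupD(3)[OF B1(2)])
        fix i assume i: "i \<in> {..<n}"
        then have "?r (g (e i)) b \<in> ?C" "?r (g (f i)) b \<in> ?C" using b by force+
        then show "form d (f i) * ?r (g (e i)) b \<in> B1" "form (e i) d * ?r (g (f i)) b \<in> B1"
          using d i B(3)[of "?r (g (e i)) b" "form d (f i)"] B(3)[of "?r (g (f i)) b" "form (e i) d"]
          unfolding box_def mult.commute[of "form _ _"] by blast+
      qed
      finally show "?r (g d) b \<in> B0" using B1(3) by blast
    qed
    then show "twist g d s = s"
      using U(3,4) by (auto simp: twist_def)
  qed
qed

text \<open>\<open>form w (g w')\<close> is a linear combination of the matrix entries of g with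
  coefficients depending only on w and \<open>w'\<close>, so finitely many such values are
  controlled at once.\<close>

lemma Sp_neighbourhood:
  assumes g0: "g0 \<in> W.Sp" and B: "openin TF B" "add_subgroup B" and P: "finite P"
  obtains T where "openin (W.Sp_topology TF) T" "g0 \<in> T" "T \<subseteq> W.Sp"
    "\<And>g w w'. g \<in> T \<Longrightarrow> (w, w') \<in> P \<Longrightarrow> form w (g w') - form w (g0 w') \<in> B"
proof -
  let ?r = "W.representation Basis"
  let ?C = "(\<lambda>((w, w'), b, b'). ?r w' b' * form w b) ` (P \<times> Basis \<times> Basis)"
  have fin: "finite ?C" using P W.finite_Basis by simp
  obtain B1 where B1: "openin TF B1" "add_subgroup B1" "\<And>c x. c \<in> ?C \<Longrightarrow> x \<in> B1 \<Longrightarrow> c * x \<in> B"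
    using small_multiples[OF B(1) add_subgroupD(1)[OF B(2)] fin] by blast
  define E where "E = (\<lambda>(b, b'). {g \<in> W.Sp. ?r (g b') b - ?r (g0 b') b \<in> B1})"
  define T where "T = \<Inter> (insert W.Sp (E ` (Basis \<times> Basis)))"
  have "openin (W.Sp_topology TF) (E (b, b'))" if b: "(b, b') \<in> Basis \<times> Basis" for b b'
  proof -
    have "continuous_map (W.Sp_topology TF) TF
        ((\<lambda>x. x (b, b')) \<circ> (\<lambda>g. \<lambda>(b, b')\<in>Basis \<times> Basis. ?r (g b') b))"
      unfolding W.Sp_topology_def
      by (rule continuous_map_pullback[OF continuous_map_product_projection[OF b]])
    moreover have "openin TF {x. 1 * x + - ?r (g0 b') b \<in> B1}"
      by (rule affine_open[OF B1(1)])
    ultimately have "openin (W.Sp_topology TF) {g \<in> topspace (W.Sp_topology TF).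
        ((\<lambda>x. x (b, b')) \<circ> (\<lambda>g. \<lambda>(b, b')\<in>Basis \<times> Basis. ?r (g b') b)) g \<in> {x. 1 * x + - ?r (g0 b') b \<in> B1}}"
      by (rule openin_continuous_map_preimage)
    then show ?thesis
      using b by (simp add: E_def topspace_Sp_topology)
  qed
  then have "openin (W.Sp_topology TF) T"
    unfolding T_def using W.finite_Basis openin_topspace[of "W.Sp_topology TF"]
    by (intro openin_Inter) (auto simp: topspace_Sp_topology)
  moreover have "g0 \<in> T" "T \<subseteq> W.Sp"
    using g0 add_subgroupD(1)[OF B1(2)] by (auto simp: T_def E_def)
  moreover have "form w (g w') - form w (g0 w') \<in> B" if g: "g \<in> T" and w: "(w, w') \<in> P" for g w w'
  proof -
    have form_eq: "form w (h w') = (\<Sum>b'\<in>Basis. \<Sum>b\<in>Basis. ?r w' b' * form w b * ?r (h b') b)" if "h \<in> W.Sp" for h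
    proof -
      interpret h: Vector_Spaces.linear scaleW scaleW h by (rule W.SpD(1)[OF that])
      have rep: "v = (\<Sum>b\<in>Basis. scaleW (?r v b) b)" for v
        using W.sum_representation_eq[of Basis v Basis] W.independent_Basis W.span_Basis W.finite_Basis by simp
      have form_rep: "form w v = (\<Sum>b\<in>Basis. ?r v b * form w b)" for v
        by (subst rep[of v]) (simp add: W.form_sum)
      have "h w' = (\<Sum>b'\<in>Basis. scaleW (?r w' b') (h b'))"
        by (subst rep[of w']) (simp add: h.sum h.scale)
      also have "form w \<dots> = (\<Sum>b'\<in>Basis. ?r w' b' * form w (h b'))"
        by (simp add: W.form_sum)
      also have "\<dots> = (\<Sum>b'\<in>Basis. ?r w' b' * (\<Sum>b\<in>Basis. ?r (h b') b * form w b))"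
        by (simp only: form_rep[of "h _"])
      finally show ?thesis
        by (simp add: sum_distrib_left mult_ac)
    qed
    have "form w (g w') - form w (g0 w')
        = (\<Sum>b'\<in>Basis. \<Sum>b\<in>Basis. ?r w' b' * form w b * (?r (g b') b - ?r (g0 b') b))"
      using g \<open>T \<subseteq> W.Sp\<close> g0 by (simp add: form_eq subsetD right_diff_distrib sum_subtractf)
    also have "\<dots> \<in> B"
    proof (intro add_subgroup_sum[OF B(2)] B1(3))
      fix b b' assume b: "b' \<in> Basis" "b \<in> Basis"
      then show "?r w' b' * form w b \<in> ?C" using w by force
      show "?r (g b') b - ?r (g0 b') b \<in> B1" using g b by (auto simp: T_def E_def)
    qed
    finally show ?thesis .
  qed
  ultimately show ?thesis by (rule that)
qed

text \<open>The coordinates of \<open>inv g w\<close> are read off from g through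
  \<open>form (inv g w) x = form w (g x)\<close>. Hence \<open>inv g w = w0 + d\<close> with d so
  small that it fixes s and its cocycle with \<open>w0\<close> is trivial.\<close>

lemma inverse_action_locally_constant:
  assumes g0: "g0 \<in> W.Sp"
  obtains T where "openin (W.Sp_topology TF) T" "g0 \<in> T" "T \<subseteq> W.Sp"
    "\<And>g. g \<in> T \<Longrightarrow> \<rho> (inv g w, 0) s = \<rho> (inv g0 w, 0) s"
proof -
  define w0 where "w0 = inv g0 w"
  obtain B1 where B1: "openin TF B1" "add_subgroup B1" "\<And>d. d \<in> box B1 B1 \<Longrightarrow> twist id d s = s"
    using smooth_box[OF id_Sp] by blast
  obtain B2 where B2: "openin TF B2" "add_subgroup B2" "B2 \<subseteq> {x. \<psi> x = 1}"
    using small_subgroup[OF psi_open] psi_simps(1) by blast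
  let ?C = "(\<lambda>i. form w0 (f i) / 2) ` {..<n} \<union> (\<lambda>i. form (e i) w0 / 2) ` {..<n}"
  have fin: "finite ?C" by simp
  obtain B3 where B3: "openin TF B3" "add_subgroup B3" "\<And>c x. c \<in> ?C \<Longrightarrow> x \<in> B3 \<Longrightarrow> c * x \<in> B2"
    using small_multiples[OF B2(1) add_subgroupD(1)[OF B2(2)] fin] by blast
  define B where "B = B1 \<inter> B3"
  have B: "openin TF B" "add_subgroup B"
    using open_subgroup_Int B1 B3 by (auto simp: B_def)
  let ?P = "(\<lambda>i. (w, e i)) ` {..<n} \<union> (\<lambda>i. (w, f i)) ` {..<n}"
  have fin: "finite ?P" by simp
  obtain T where T: "openin (W.Sp_topology TF) T" "g0 \<in> T" "T \<subseteq> W.Sp"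
    "\<And>g w w'. g \<in> T \<Longrightarrow> (w, w') \<in> ?P \<Longrightarrow> form w (g w') - form w (g0 w') \<in> B"
    using Sp_neighbourhood[OF g0 B fin] by blast
  show ?thesis
  proof (rule that[OF T(1-3)])
    fix g assume g: "g \<in> T"
    then have Sp: "g \<in> W.Sp" using T(3) by blast
    define d where "d = inv g w - w0"
    have d_box: "d \<in> box B B"
      unfolding box_def
    proof (intro CollectI allI impI conjI)
      fix i assume i: "i < n"
      have "form w (g (f i)) - form w (g0 (f i)) \<in> B" "form w (g (e i)) - form w (g0 (e i)) \<in> B"
        using T(4)[OF g] i by auto
      moreover have "form d x = form w (g x) - form w (g0 x)" for x
        by (simp add: d_def w0_def W.SpD(10)[OF Sp] W.SpD(10)[OF g0])
      ultimately have "form d (f i) \<in> B" "form d (e i) \<in> B" by simp_all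
      then show "form d (f i) \<in> B" "form (e i) d \<in> B"
        using add_subgroupD(2)[OF B(2)] W.form_commute[of "e i" d] by simp_all
    qed
    have "form w0 d / 2 = (\<Sum>i<n. form w0 (f i) / 2 * form (e i) d - form (e i) w0 / 2 * form d (f i))"
      by (simp add: form_coordinates[of w0 d] sum_divide_distrib diff_divide_distrib)
    also have "\<dots> \<in> B2"
    proof (intro add_subgroup_sum[OF B2(2)] add_subgroupD(4)[OF B2(2)] B3(3))
      fix i assume "i \<in> {..<n}"
      then show "form w0 (f i) / 2 \<in> ?C" "form (e i) w0 / 2 \<in> ?C" "form (e i) d \<in> B3" "form d (f i) \<in> B3"
        using d_box by (auto simp: box_def B_def)
    qed
    finally have "\<psi> (form w0 d / 2) = 1" using B2(3) by blast
    then have "twist id w0 (twist id d s) = twist id (w0 + d) s"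
      by (simp add: weyl.weyl_systemD(2)[OF twist_system[OF id_Sp]])
    moreover have "twist id d s = s"
      using B1(3) d_box by (auto simp: box_def B_def)
    ultimately show "\<rho> (inv g w, 0) s = \<rho> (inv g0 w, 0) s"
      by (simp add: twist_def d_def w0_def)
  qed
qed

text \<open>\<open>inv g0 \<circ> g\<close> is close to the identity. It moves each l by some m
  whose halved coordinates lie in \<open>A \<inter> D\<close>, uniformly in l, because
  \<open>small_products\<close> covers all coordinates of l.\<close>

lemma lattice_stable_near:
  assumes g0: "g0 \<in> W.Sp"
  obtains T where "openin (W.Sp_topology TF) T" "g0 \<in> T" "T \<subseteq> W.Sp"
    "\<And>g l. g \<in> T \<Longrightarrow> l \<in> L \<Longrightarrow> inv g0 (g l) \<in> L \<and> \<theta> (inv g0 (g l)) = \<theta> l"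
proof -
  obtain B0 where B0: "openin TF B0" "0 \<in> B0" "\<And>x b. x \<in> insert 1 (A \<union> D) \<Longrightarrow> b \<in> B0 \<Longrightarrow> x * b / 2 \<in> A \<inter> D"
    using small_products by blast
  obtain B where B: "openin TF B" "add_subgroup B" "B \<subseteq> B0"
    using small_subgroup[OF B0(1,2)] by blast
  let ?E = "e ` {..<n} \<union> f ` {..<n}"
  let ?P = "(\<lambda>(x, y). (g0 x, y)) ` (?E \<times> ?E)"
  have fin: "finite ?P" by simp
  obtain T where T: "openin (W.Sp_topology TF) T" "g0 \<in> T" "T \<subseteq> W.Sp"
    "\<And>g w w'. g \<in> T \<Longrightarrow> (w, w') \<in> ?P \<Longrightarrow> form w (g w') - form w (g0 w') \<in> B"
    using Sp_neighbourhood[OF g0 B(1,2) fin] by blast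
  note G0 = W.SpD[OF g0]
  show ?thesis
  proof (rule that[OF T(1-3)])
    fix g l assume g: "g \<in> T" and l: "l \<in> L"
    interpret k: Vector_Spaces.linear scaleW scaleW "inv g0 \<circ> g"
      using T(3) g g0 W.SpD(1,9) by (intro Vector_Spaces.linear_compose) blast+
    let ?k = "inv g0 \<circ> g"
    define m where "m = ?k l - l"
    have AD: "add_subgroup (A \<inter> D)"
      by (intro add_subgroup_Int A_subgroup D_subgroup)
    have near: "form x (?k y - y) \<in> B" if "x \<in> ?E" "y \<in> ?E" for x y
    proof -
      have "form x (?k y - y) = form (g0 x) (g y) - form (g0 x) (g0 y)"
        using G0(3)[of x "inv g0 (g y)"] G0(3)[of x y] G0(8) by simp
      moreover have "(g0 x, y) \<in> ?P" using that by force
      ultimately show ?thesis using T(4)[OF g] by metis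
    qed
    have small: "form x m / 2 \<in> A \<inter> D" if x: "x \<in> ?E" for x
    proof -
      have "?k l = (\<Sum>i<n. scaleW (form l (f i)) (?k (e i)) + scaleW (form (e i) l) (?k (f i)))"
        by (subst expand[of l]) (simp only: k.sum k.add k.scale)
      then have "m = (\<Sum>i<n. scaleW (form l (f i)) (?k (e i)) + scaleW (form (e i) l) (?k (f i)))
          - (\<Sum>i<n. scaleW (form l (f i)) (e i) + scaleW (form (e i) l) (f i))"
        unfolding m_def using expand[of l] by simp
      also have "\<dots> = (\<Sum>i<n. scaleW (form l (f i)) (?k (e i) - e i) + scaleW (form (e i) l) (?k (f i) - f i))"
        by (simp add: sum_subtractf[symmetric] W.scale_right_diff_distrib algebra_simps)
      finally have "form x m / 2 = (\<Sum>i<n. form l (f i) * form x (?k (e i) - e i) / 2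
          + form (e i) l * form x (?k (f i) - f i) / 2)"
        by (simp only: W.form_sum W.form_simps(2,4) sum_divide_distrib add_divide_distrib)
      also have "\<dots> \<in> A \<inter> D"
      proof (intro add_subgroup_sum[OF AD] add_subgroupD(3)[OF AD] B0(3))
        fix i assume i: "i \<in> {..<n}"
        show "form l (f i) \<in> insert 1 (A \<union> D)" "form (e i) l \<in> insert 1 (A \<union> D)"
          using l i by (auto simp: L_def box_def)
        show "form x (?k (e i) - e i) \<in> B0" "form x (?k (f i) - f i) \<in> B0"
          using near[OF x] i B(3) by blast+
      qed
      finally show ?thesis .
    qed
    have half: "form m (f i) / 2 \<in> A \<inter> D" "form (e i) m / 2 \<in> A \<inter> D" if "i < n" for i
    proof -
      show "form (e i) m / 2 \<in> A \<inter> D" using small that by blast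
      have "form (f i) m / 2 \<in> A \<inter> D" using small that by blast
      then have "- (form (f i) m / 2) \<in> A \<inter> D" by (rule add_subgroupD(2)[OF AD])
      then show "form m (f i) / 2 \<in> A \<inter> D" using W.form_commute[of m "f i"] by simp
    qed
    have double: "x \<in> N" if "x / 2 \<in> N" "add_subgroup N" for x and N :: "'f set"
      using add_subgroupD(3)[OF that(2) that(1) that(1)] two_nonzero by (simp add: field_simps)
    have mL: "m \<in> L"
      using half double[OF _ A_subgroup] double[OF _ D_subgroup] by (auto simp: L_def box_def)
    have kl: "?k l = l + m" by (simp add: m_def)
    then have "?k l \<in> L"
      using add_subgroupD(3)[OF weyl.L_subgroup l mL] by simp
    moreover have "\<theta> (?k l) = \<theta> l"
    proof -
      let ?a = "\<lambda>i. form l (f i)" and ?b = "\<lambda>i. form (e i) l"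
      let ?x = "\<lambda>i. form m (f i)" and ?y = "\<lambda>i. form (e i) m"
      \<comment> \<open>Half the change of the quadratic function, arranged so that every summand is
        a product of an element of A and one of D.\<close>
      let ?t = "\<lambda>i. ?a i * (?y i / 2) + ?x i / 2 * ?b i + ?x i * (?y i / 2)"
      have "(\<Sum>i<n. form (l + m) (f i) * form (e i) (l + m)) / 2 = (\<Sum>i<n. ?a i * ?b i) / 2 + (\<Sum>i<n. ?t i)"
        unfolding sum_divide_distrib sum.distrib[symmetric]
        by (intro sum.cong refl) (simp add: algebra_simps add_divide_distrib)
      moreover have "\<psi> (\<Sum>i<n. ?t i) = 1"
      proof (rule psi_sum_eq_1)
        fix i assume "i \<in> {..<n}"
        then have "?a i \<in> A" "?b i \<in> D" "?x i \<in> A" "?x i / 2 \<in> A" "?y i / 2 \<in> D"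
          using l mL half[of i] by (auto simp: L_def box_def)
        then show "\<psi> (?t i) = 1"
          by (simp only: psi_add psi_A_D mult_1_right)
      qed
      ultimately show ?thesis
        by (simp only: kl \<theta>_def psi_add mult_1_right)
    qed
    ultimately show "inv g0 (g l) \<in> L \<and> \<theta> (inv g0 (g l)) = \<theta> l" by simp
  qed
qed

text \<open>On L, \<open>twist g\<close> is \<open>twist g0\<close> after
  \<open>inv g0 \<circ> g\<close>, which maps L into L and respects \<open>\<theta>\<close>. It maps
  onto L: it preserves the form, so the preimage of a vector of L is orthogonal to L and thus lies
  in L.\<close>

lemma lattice_vectors_locally_constant:
  assumes g0: "g0 \<in> W.Sp"
  obtains T where "openin (W.Sp_topology TF) T" "g0 \<in> T" "T \<subseteq> W.Sp"
    "\<And>g. g \<in> T \<Longrightarrow> weyl.lattice_vector (twist g) = weyl.lattice_vector (twist g0)"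
proof -
  obtain T where T: "openin (W.Sp_topology TF) T" "g0 \<in> T" "T \<subseteq> W.Sp"
    "\<And>g l. g \<in> T \<Longrightarrow> l \<in> L \<Longrightarrow> inv g0 (g l) \<in> L \<and> \<theta> (inv g0 (g l)) = \<theta> l"
    using lattice_stable_near[OF g0] by blast
  show ?thesis
  proof (rule that[OF T(1-3)], rule ext)
    fix g u assume g: "g \<in> T"
    then have Sp: "g \<in> W.Sp" using T(3) by blast
    have eq: "twist g l = twist g0 (inv g0 (g l))" for l
      by (simp add: twist_def W.SpD(8)[OF g0])
    have onto: "\<exists>l'\<in>L. l = inv g0 (g l')" if l: "l \<in> L" for l
    proof
      let ?l' = "inv g (g0 l)"
      show "l = inv g0 (g ?l')"
        by (simp add: W.SpD(8)[OF Sp] W.SpD(7)[OF g0])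
      have "\<psi> (form l'' ?l') = 1" if l'': "l'' \<in> L" for l''
      proof -
        have "form l'' ?l' = form (g l'') (g0 l)"
          using W.SpD(3)[OF Sp, of l'' ?l'] W.SpD(8)[OF Sp] by simp
        also have "\<dots> = form (inv g0 (g l'')) l"
          by (simp add: W.SpD(10)[OF g0])
        finally show ?thesis
          using L_isotropic[OF _ l] T(4)[OF g l''] by simp
      qed
      then show "?l' \<in> L" using weyl.L_perp by blast
    qed
    show "weyl.lattice_vector (twist g) u = weyl.lattice_vector (twist g0) u"
      unfolding weyl.lattice_vector_def
    proof (intro conj_cong refl iffI ballI)
      fix l assume h: "\<forall>l\<in>L. twist g l u = scaleS (\<theta> l) u" and l: "l \<in> L"
      obtain l' where "l' \<in> L" "l = inv g0 (g l')" using onto[OF l] by blast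
      then show "twist g0 l u = scaleS (\<theta> l) u"
        using h T(4)[OF g] eq by metis
    next
      fix l assume "\<forall>l\<in>L. twist g0 l u = scaleS (\<theta> l) u" "l \<in> L"
      then show "twist g l u = scaleS (\<theta> l) u"
        using T(4)[OF g] eq by metis
    qed
  qed
qed

text \<open>Supplies the starting point of the enlargement: a nonzero s is fixed by a small box, and
  inside it \<open>\<theta>\<close> is trivial on a still smaller one, so s is an eigenvector
  there.\<close>

lemma exists_lattice_vector:
  assumes g: "g \<in> W.Sp"
  shows "\<exists>u. weyl.lattice_vector (twist g) u"
proof -
  obtain s :: 's where s: "s \<noteq> 0" using nonzero by blast
  obtain B1 where B1: "openin TF B1" "add_subgroup B1" "\<And>d. d \<in> box B1 B1 \<Longrightarrow> twist g d s = s"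
    using smooth_box[OF g] by blast
  obtain B0 where B0: "openin TF B0" "0 \<in> B0" "\<And>x b. x \<in> insert 1 (A \<union> D) \<Longrightarrow> b \<in> B0 \<Longrightarrow> x * b / 2 \<in> A \<inter> D"
    using small_products by blast
  have B: "openin TF (B1 \<inter> B0)" "0 \<in> B1 \<inter> B0"
    using B1 B0 add_subgroupD(1) by auto
  obtain A' k X where A': "A' \<subseteq> A \<inter> (B1 \<inter> B0)" "add_subgroup A'"
    "\<forall>x. (\<forall>y. (\<forall>c\<in>A'. \<psi> (c * y) = 1) \<longrightarrow> \<psi> (x * y) = 1) \<longrightarrow> x \<in> A'"
    "\<forall>x\<in>A. of_nat (p ^ k) * x \<in> A'" "finite X" "\<forall>x\<in>A. \<exists>a\<in>X. x - a \<in> A'"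
    using sublattice[OF insertI1 B] by (elim exE conjE) (rule that)
  obtain D' k' X' where D': "D' \<subseteq> D \<inter> (B1 \<inter> B0)" "add_subgroup D'"
    "\<forall>x. (\<forall>y. (\<forall>c\<in>D'. \<psi> (c * y) = 1) \<longrightarrow> \<psi> (x * y) = 1) \<longrightarrow> x \<in> D'"
    "\<forall>x\<in>D. of_nat (p ^ k') * x \<in> D'" "finite X'" "\<forall>x\<in>D. \<exists>a\<in>X'. x - a \<in> D'"
    using sublattice[OF insertI2[OF singletonI] B] by (elim exE conjE) (rule that)
  let ?N = "box A' D'"
  let ?X = "(\<lambda>(a, b). combination a b) ` ((\<Pi>\<^sub>E i\<in>{..<n}. X) \<times> (\<Pi>\<^sub>E i\<in>{..<n}. X'))"
  have N_L: "?N \<subseteq> L" using A'(1) D'(1) by (auto simp: box_def L_def)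
  have closed: "weyl.perp_closed ?N"
    unfolding weyl.perp_closed_def
  proof (intro allI impI)
    fix z assume z: "\<forall>y\<in>weyl.perp ?N. \<psi> (form z y) = 1"
    have "form z (f i) \<in> A' \<and> form (e i) z \<in> D'" if i: "i < n" for i
    proof
      show "form z (f i) \<in> A'"
      proof (rule A'(3)[THEN spec, THEN mp], intro allI impI)
        fix y assume y: "\<forall>c\<in>A'. \<psi> (c * y) = 1"
        \<comment> \<open>This vector pairs only with the coordinate along \<open>e i\<close>, so
          double orthogonality of the box reduces to that of its factors.\<close>
        have "scaleW y (f i) \<in> weyl.perp ?N"
          using y i by (auto simp: weyl.perp_def box_def mult.commute)
        then have "\<psi> (form z (scaleW y (f i))) = 1" using z by blast
        then show "\<psi> (form z (f i) * y) = 1" by (simp add: mult.commute)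
      qed
      show "form (e i) z \<in> D'"
      proof (rule D'(3)[THEN spec, THEN mp], intro allI impI)
        fix y assume y: "\<forall>c\<in>D'. \<psi> (c * y) = 1"
        have "scaleW y (e i) \<in> weyl.perp ?N"
          using y i W.form_commute[of _ "e i"] by (auto simp: weyl.perp_def box_def mult.commute psi_simps)
        then have "\<psi> (form z (scaleW y (e i))) = 1" using z by blast
        then show "\<psi> (form (e i) z * y) = 1"
          using W.form_commute[of z "e i"] by (simp add: mult.commute psi_simps)
      qed
    qed
    then show "z \<in> ?N" by (simp add: box_def)
  qed
  have power: "scaleW (of_nat (p ^ (k + k'))) l \<in> ?N" if l: "l \<in> L" for l
  proof -
    have "of_nat (p ^ (k + k')) * x \<in> A'" if "x \<in> A" for x
      using add_subgroup_of_nat_mult[OF A'(2) bspec[OF A'(4) that], of "p ^ k'"]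
      by (simp add: power_add mult_ac)
    moreover have "of_nat (p ^ (k + k')) * x \<in> D'" if "x \<in> D" for x
      using add_subgroup_of_nat_mult[OF D'(2) bspec[OF D'(4) that], of "p ^ k"]
      by (simp add: power_add mult_ac)
    ultimately show ?thesis
      using l by (simp add: box_def L_def)
  qed
  have "finite ?X"
    using A'(5) D'(5) by (intro finite_imageI finite_cartesian_product finite_PiE) auto
  moreover have "\<exists>a\<in>?X. l - a \<in> ?N" if l: "l \<in> L" for l
  proof -
    have "\<forall>i<n. \<exists>a. a \<in> X \<and> form l (f i) - a \<in> A'" "\<forall>i<n. \<exists>a. a \<in> X' \<and> form (e i) l - a \<in> D'"
      using A'(6) D'(6) l by (auto simp: box_def L_def Bex_def)
    then obtain a b where ab: "\<And>i. i < n \<Longrightarrow> a i \<in> X \<and> form l (f i) - a i \<in> A'"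
      "\<And>i. i < n \<Longrightarrow> b i \<in> X' \<and> form (e i) l - b i \<in> D'"
      by metis
    \<comment> \<open>Restriction makes the coefficient functions extensional, as required for
      membership in the finite set \<open>?X\<close>.\<close>
    let ?c = "combination (restrict a {..<n}) (restrict b {..<n})"
    have "l - ?c \<in> ?N"
      using ab by (simp add: box_def form_combination)
    moreover have "?c \<in> ?X"
      using ab by (intro image_eqI[of _ _ "(restrict a {..<n}, restrict b {..<n})"]) auto
    ultimately show ?thesis by blast
  qed
  moreover have "twist g m s = scaleS (\<theta> m) s" if m: "m \<in> ?N" for m
  proof -
    have "\<theta> m = 1"
      unfolding \<theta>_def sum_divide_distrib
    proof (rule psi_sum_eq_1)
      fix i assume i: "i \<in> {..<n}"
      \<comment> \<open>The element 1 in \<open>small_products\<close> serves this step: it puts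
        half the coordinate itself into D.\<close>
      have "1 * form (e i) m / 2 \<in> A \<inter> D"
        using m i D'(1) by (intro B0(3)) (auto simp: box_def)
      then have "\<psi> (form m (f i) * (form (e i) m / 2)) = 1"
        using m i A'(1) by (intro psi_A_D) (auto simp: box_def)
      then show "\<psi> (form m (f i) * form (e i) m / 2) = 1" by simp
    qed
    moreover have "m \<in> box B1 B1" using m A'(1) D'(1) by (auto simp: box_def)
    ultimately show ?thesis using B1(3) by simp
  qed
  ultimately show ?thesis
    using weyl.exists_lattice_vector[OF twist_system[OF g] prime_p p_nonzero
        box_subgroup[OF A'(2) D'(2)] N_L closed power _ _ s] by metis
qed

text \<open>The choice depends on \<open>g\<close> only through the predicate, which is locally constant in \<open>g\<close>.  This is
  what makes the section below continuous.\<close>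
definition base_vector :: "('w \<Rightarrow> 'w) \<Rightarrow> 's" where
  "base_vector g = (SOME u. weyl.lattice_vector (twist g) u)"

lemma base_vector: "g \<in> W.Sp \<Longrightarrow> weyl.lattice_vector (twist g) (base_vector g)"
  unfolding base_vector_def using exists_lattice_vector by (rule someI_ex)

text \<open>For g in Sp, the condition on \<open>base_vector\<close> fixes the scalar, as the orbit
  of \<open>base_vector g\<close> spans.\<close>

definition lift :: "('w \<Rightarrow> 'w) \<Rightarrow> 's \<Rightarrow> 's" where
  "lift g = (SOME M. Vector_Spaces.linear scaleS scaleS M \<and> bij M \<and>
     M (base_vector g) = base_vector id \<and> (\<forall>w s. M (twist g w s) = twist id w (M s)))"

lemma lift:
  assumes "g \<in> W.Sp"
  shows "Vector_Spaces.linear scaleS scaleS (lift g)" "bij (lift g)"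
    "lift g (base_vector g) = base_vector id" "lift g (twist g w s) = twist id w (lift g s)"
    "lift g (\<rho> (w, t) s) = \<rho> (inv g w, t) (lift g s)"
    "lift g (scaleS c s) = scaleS c (lift g s)" "lift g (s + s') = lift g s + lift g s'" "lift g 0 = 0"
    "lift g s = 0 \<longleftrightarrow> s = 0"
proof -
  have "\<exists>M. Vector_Spaces.linear scaleS scaleS M \<and> bij M \<and>
     M (base_vector g) = base_vector id \<and> (\<forall>w s. M (twist g w s) = twist id w (M s))"
    using weyl.exists_intertwiner[OF twist_irreducible[OF assms] base_vector[OF assms]
        twist_irreducible[OF id_Sp] base_vector[OF id_Sp]] by metis
  then have *: "Vector_Spaces.linear scaleS scaleS (lift g) \<and> bij (lift g) \<and>
     lift g (base_vector g) = base_vector id \<and> (\<forall>w s. lift g (twist g w s) = twist id w (lift g s))"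
    unfolding lift_def by (rule someI_ex)
  then show "Vector_Spaces.linear scaleS scaleS (lift g)" "bij (lift g)"
    "lift g (base_vector g) = base_vector id" "lift g (twist g w s) = twist id w (lift g s)"
    by blast+
  interpret l: Vector_Spaces.linear scaleS scaleS "lift g" using * by blast
  show "lift g (scaleS c s) = scaleS c (lift g s)" "lift g (s + s') = lift g s + lift g s'" "lift g 0 = 0"
    by (fact l.scale l.add l.zero)+
  show "lift g s = 0 \<longleftrightarrow> s = 0"
    using * l.zero by (metis bij_is_inj injD)
  have "lift g (\<rho> (w, 0) s) = \<rho> (inv g w, 0) (lift g s)"
    using * W.SpD(8)[OF assms, of w] unfolding twist_def by (metis id_apply)
  then show "lift g (\<rho> (w, t) s) = \<rho> (inv g w, t) (lift g s)"
    by (simp add: rho_center[of _ t] l.scale)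
qed

section \<open>The fibres of \<open>Mp\<close> and local constancy of the lifts\<close>

lemma Mp_iff: "(g, M) \<in> Mp \<longleftrightarrow> g \<in> W.Sp \<and> M \<in> GL scaleS \<and> (\<forall>w t s. M (\<rho> (w, t) s) = \<rho> (inv g w, t) (M s))"
proof -
  have "(\<forall>w t. M \<circ> \<rho> (w, t) \<circ> inv M = \<rho> (inv g w, t)) \<longleftrightarrow>
      (\<forall>w t s. M (\<rho> (w, t) s) = \<rho> (inv g w, t) (M s))" if "bij M"
    using that by (auto simp: fun_eq_iff bij_is_inj bij_is_surj surj_f_inv_f) (metis bij_is_inj inv_f_f)
  then show ?thesis by (auto simp: Mp_def GL_def)
qed

lemma scaled_lift_Mp:
  assumes "g \<in> W.Sp" "c \<noteq> 0"
  shows "(g, \<lambda>s. scaleS c (lift g s)) \<in> Mp"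
proof -
  note l = lift[OF assms(1)]
  have "bij (\<lambda>s. scaleS c s)"
    using assms(2) by (intro o_bij[of "scaleS (inverse c)"]) (auto simp: fun_eq_iff)
  then have "bij (\<lambda>s. scaleS c (lift g s))"
    using bij_comp[OF l(2)] by (simp add: comp_def)
  moreover have "Vector_Spaces.linear scaleS scaleS (\<lambda>s. scaleS c (lift g s))"
    by (rule weyl.SS.linear_compose_scale_right[OF l(1)])
  ultimately show ?thesis
    using assms by (simp add: Mp_iff GL_def l(5) rho_simps)
qed

text \<open>M sends \<open>base_vector g\<close> to a lattice vector of \<open>twist id\<close>,
  hence to a multiple of \<open>base_vector id\<close>. So M and that multiple of
  \<open>lift g\<close> agree on a spanning orbit.\<close>

lemma Mp_scaled_lift:
  assumes "(g, M) \<in> Mp"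
  shows "\<exists>c. c \<noteq> 0 \<and> M = (\<lambda>s. scaleS c (lift g s))"
proof -
  have g: "g \<in> W.Sp" and M: "Vector_Spaces.linear scaleS scaleS M" "bij M"
    "\<And>w t s. M (\<rho> (w, t) s) = \<rho> (inv g w, t) (M s)"
    using assms by (auto simp: Mp_iff GL_def)
  interpret M: Vector_Spaces.linear scaleS scaleS M by (rule M(1))
  note l = lift[OF g]
  let ?u = "base_vector g"
  have u: "?u \<noteq> 0" "\<And>l. l \<in> L \<Longrightarrow> twist g l ?u = scaleS (\<theta> l) ?u"
    using base_vector[OF g] by (auto simp: weyl.lattice_vector_def)
  have tw: "M (twist g w s) = twist id w (M s)" for w s
    by (simp add: twist_def M(3) W.SpD(7)[OF g])
  have Mu: "M ?u \<noteq> 0"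
    using u(1) M(2) M.zero by (metis bij_is_inj injD)
  have "weyl.lattice_vector (twist id) (M ?u)"
    unfolding weyl.lattice_vector_def
  proof (intro conjI ballI Mu)
    fix l assume "l \<in> L"
    then show "twist id l (M ?u) = scaleS (\<theta> l) (M ?u)"
      using u(2) tw M.scale by metis
  qed
  then obtain c where c: "M ?u = scaleS c (base_vector id)"
    using weyl.lattice_vector_unique[OF twist_irreducible[OF id_Sp] base_vector[OF id_Sp]] by blast
  have "M s = scaleS c (lift g s)" for s
  proof (rule weyl.SS.linear_eq_on[OF M(1) weyl.SS.linear_compose_scale_right[OF l(1)]])
    show "s \<in> S.span (range (\<lambda>w. twist g w ?u))"
      using weyl.span_orbit[OF twist_irreducible[OF g] u(1)] by simp
    fix x assume "x \<in> range (\<lambda>w. twist g w ?u)"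
    then obtain w where "x = twist g w ?u" by blast
    then show "M x = scaleS c (lift g x)"
      by (simp add: tw l(3,4) c) (simp add: twist_def rho_simps)
  qed
  moreover have "c \<noteq> 0" using c Mu by auto
  ultimately show ?thesis by blast
qed

text \<open>The vectors s with this property form a subspace, since two neighbourhoods can be
  intersected. It contains the spanning orbit of \<open>base_vector g0\<close>: near
  \<open>g0\<close> neither the base vector nor the image of a given translate changes.\<close>

lemma lift_locally_constant:
  assumes g0: "g0 \<in> W.Sp"
  shows "\<exists>T. openin (W.Sp_topology TF) T \<and> g0 \<in> T \<and> T \<subseteq> W.Sp \<and> (\<forall>g\<in>T. lift g s = lift g0 s)"
proof -
  let ?near = "\<lambda>P. \<exists>T. openin (W.Sp_topology TF) T \<and> g0 \<in> T \<and> T \<subseteq> W.Sp \<and> (\<forall>g\<in>T. P g)"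
  have nearI: "?near P" if "openin (W.Sp_topology TF) T" "g0 \<in> T" "T \<subseteq> W.Sp" "\<And>g. g \<in> T \<Longrightarrow> P g" for T P
    using that by blast
  have near_conj: "?near (\<lambda>g. P g \<and> Q g)" if PQ: "?near P" "?near Q" for P Q
  proof -
    obtain T where T: "openin (W.Sp_topology TF) T" "g0 \<in> T" "T \<subseteq> W.Sp" "\<forall>g\<in>T. P g"
      using PQ(1) by blast
    obtain T' where T': "openin (W.Sp_topology TF) T'" "g0 \<in> T'" "T' \<subseteq> W.Sp" "\<forall>g\<in>T'. Q g"
      using PQ(2) by blast
    show ?thesis
      using T T' by (intro exI[of _ "T \<inter> T'"]) auto
  qed
  let ?V = "{s. ?near (\<lambda>g. lift g s = lift g0 s)}"
  let ?u = "base_vector g0"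
  have "S.subspace ?V"
  proof (rule S.subspaceI)
    have "openin (W.Sp_topology TF) W.Sp"
      by (metis openin_topspace topspace_Sp_topology)
    moreover have "lift g 0 = lift g0 0" if "g \<in> W.Sp" for g
      using lift(8)[OF that] lift(8)[OF g0] by simp
    ultimately show "0 \<in> ?V"
      by (intro CollectI nearI[OF _ g0 subset_refl])
  next
    fix x y assume x: "x \<in> ?V" and y: "y \<in> ?V"
    have "?near (\<lambda>g. lift g x = lift g0 x \<and> lift g y = lift g0 y)"
      by (rule near_conj[OF CollectD[OF x] CollectD[OF y]])
    then obtain T where T: "openin (W.Sp_topology TF) T" "g0 \<in> T" "T \<subseteq> W.Sp"
      "\<forall>g\<in>T. lift g x = lift g0 x \<and> lift g y = lift g0 y"
      by blast
    have "lift g (x + y) = lift g0 (x + y)" if "g \<in> T" for g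
      using bspec[OF T(4) that] lift(7)[OF subsetD[OF T(3) that]] lift(7)[OF g0] by simp
    with T(1-3) show "x + y \<in> ?V"
      by (intro CollectI nearI)
  next
    fix c x assume "x \<in> ?V"
    then obtain T where T: "openin (W.Sp_topology TF) T" "g0 \<in> T" "T \<subseteq> W.Sp"
      "\<forall>g\<in>T. lift g x = lift g0 x"
      by blast
    have "lift g (scaleS c x) = lift g0 (scaleS c x)" if "g \<in> T" for g
      using bspec[OF T(4) that] lift(6)[OF subsetD[OF T(3) that]] lift(6)[OF g0] by simp
    with T(1-3) show "scaleS c x \<in> ?V"
      by (intro CollectI nearI)
  qed
  moreover have "range (\<lambda>w. twist g0 w ?u) \<subseteq> ?V"
  proof
    fix x assume "x \<in> range (\<lambda>w. twist g0 w ?u)"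
    then obtain w where x: "x = \<rho> (w, 0) ?u" by (auto simp: twist_def)
    obtain T1 where T1: "openin (W.Sp_topology TF) T1" "g0 \<in> T1" "T1 \<subseteq> W.Sp"
      "\<And>g. g \<in> T1 \<Longrightarrow> weyl.lattice_vector (twist g) = weyl.lattice_vector (twist g0)"
      using lattice_vectors_locally_constant[OF g0] by blast
    obtain T2 where T2: "openin (W.Sp_topology TF) T2" "g0 \<in> T2" "T2 \<subseteq> W.Sp"
      "\<And>g. g \<in> T2 \<Longrightarrow> \<rho> (inv g w, 0) (base_vector id) = \<rho> (inv g0 w, 0) (base_vector id)"
      using inverse_action_locally_constant[OF g0] by blast
    have "lift g x = lift g0 x" if g: "g \<in> T1 \<inter> T2" for g
    proof -
      have Sp: "g \<in> W.Sp" using g T1(3) by blast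
      have "weyl.lattice_vector (twist g) = weyl.lattice_vector (twist g0)"
        using T1(4) g by blast
      then have "base_vector g = ?u" by (simp add: base_vector_def)
      then have "lift g x = \<rho> (inv g w, 0) (base_vector id)"
        using lift(3)[OF Sp] by (simp add: x lift(5)[OF Sp])
      also have "\<dots> = \<rho> (inv g0 w, 0) (base_vector id)"
        using T2(4) g by blast
      also have "\<dots> = lift g0 x"
        by (simp add: x lift(3,5)[OF g0])
      finally show ?thesis .
    qed
    moreover have "openin (W.Sp_topology TF) (T1 \<inter> T2)" "g0 \<in> T1 \<inter> T2" "T1 \<inter> T2 \<subseteq> W.Sp"
      using T1 T2 by auto
    ultimately show "x \<in> ?V"
      by (intro CollectI nearI[of "T1 \<inter> T2"])
  qed
  ultimately have "S.span (range (\<lambda>w. twist g0 w ?u)) \<subseteq> ?V"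
    by (intro S.span_minimal)
  moreover have "S.span (range (\<lambda>w. twist g0 w ?u)) = UNIV"
    using weyl.span_orbit[OF twist_irreducible[OF g0]] base_vector[OF g0] by (simp add: weyl.lattice_vector_def)
  ultimately show ?thesis by auto
qed

text \<open>The generating open sets of \<open>GL_topology\<close> prescribe one value of the
  operator, so continuity in that component is local constancy of each value.\<close>

lemma continuous_map_into_Mp:
  assumes fst: "continuous_map X (W.Sp_topology TF) h"
    and Mp: "\<And>x. x \<in> topspace X \<Longrightarrow> (h x, M x) \<in> Mp"
    and loc: "\<And>x s. x \<in> topspace X \<Longrightarrow> \<exists>T. openin X T \<and> x \<in> T \<and> (\<forall>y\<in>T. M y s = M x s)"
  shows "continuous_map X Mp_topology (\<lambda>x. (h x, M x))"
  unfolding Mp_topology_def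
proof (rule continuous_map_into_subtopology)
  have "continuous_map X (GL_topology scaleS) M"
    unfolding GL_topology_def
  proof (rule continuous_on_generated_topo)
    fix U assume "U \<in> {{M \<in> GL scaleS. M s = s'} |s s'. True}"
    then obtain s s' where U: "U = {M \<in> GL scaleS. M s = s'}" by blast
    show "openin X (M -` U \<inter> topspace X)"
    proof (subst openin_subopen, intro ballI)
      fix x assume x: "x \<in> M -` U \<inter> topspace X"
      then have "x \<in> topspace X" by simp
      from loc[OF this, of s] obtain T where T: "openin X T" "x \<in> T" "\<forall>y\<in>T. M y s = M x s"
        by blast
      have "M x s = s'" using x by (simp add: U)
      then have "y \<in> M -` U \<inter> topspace X" if y: "y \<in> T" for y
        using bspec[OF T(3) y] openin_subset[OF T(1)] y Mp[of y] by (auto simp: U Mp_def)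
      then show "\<exists>T. openin X T \<and> x \<in> T \<and> T \<subseteq> M -` U \<inter> topspace X"
        using T(1,2) by blast
    qed
  next
    show "M ` topspace X \<subseteq> \<Union> {{M \<in> GL scaleS. M s = s'} |s s'. True}"
      using Mp by (auto simp: Mp_def)
  qed
  with fst show "continuous_map X (prod_topology (W.Sp_topology TF) (GL_topology scaleS)) (\<lambda>x. (h x, M x))"
    by (simp add: continuous_map_pairedI)
  show "(\<lambda>x. (h x, M x)) \<in> topspace X \<rightarrow> Mp" using Mp by blast
qed

section \<open>The fibre coordinate and the global trivialisation\<close>

definition scalar :: "('w \<Rightarrow> 'w) \<times> ('s \<Rightarrow> 's) \<Rightarrow> 'r" where
  "scalar x = (THE c. c \<noteq> 0 \<and> snd x = (\<lambda>s. scaleS c (lift (fst x) s)))"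

lemma scalar_eqI:
  assumes g: "g \<in> W.Sp" and s: "s \<noteq> 0" and eq: "scaleS c (lift g s) = scaleS c' (lift g s)"
  shows "c = c'"
  by (rule S.scale_right_imp_eq[OF _ eq]) (simp add: lift(9)[OF g] s)

lemma scalar:
  assumes "(g, M) \<in> Mp"
  shows "scalar (g, M) \<noteq> 0" "M s = scaleS (scalar (g, M)) (lift g s)"
proof -
  have g: "g \<in> W.Sp" using assms by (simp add: Mp_iff)
  obtain s0 :: 's where s0: "s0 \<noteq> 0" using nonzero by blast
  obtain c where c: "c \<noteq> 0" "M = (\<lambda>s. scaleS c (lift g s))"
    using Mp_scaled_lift[OF assms] by blast
  have "scalar (g, M) = c"
    unfolding scalar_def
  proof (rule the_equality)
    fix c' assume "c' \<noteq> 0 \<and> snd (g, M) = (\<lambda>s. scaleS c' (lift (fst (g, M)) s))"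
    then have "(\<lambda>s. scaleS c' (lift g s)) = (\<lambda>s. scaleS c (lift g s))"
      using c(2) by (simp only: fst_conv snd_conv)
    then have "scaleS c' (lift g s0) = scaleS c (lift g s0)"
      by (rule fun_cong)
    then show "c' = c" by (rule scalar_eqI[OF g s0])
  qed (use c in simp)
  then show "scalar (g, M) \<noteq> 0" "M s = scaleS (scalar (g, M)) (lift g s)"
    using c by simp_all
qed

lemma scalar_scaled_lift:
  assumes "g \<in> W.Sp" "c \<noteq> 0"
  shows "scalar (g, \<lambda>s. scaleS c (lift g s)) = c"
proof -
  obtain s :: 's where "s \<noteq> 0" using nonzero by blast
  then show ?thesis
    using scalar_eqI[OF assms(1)] scalar(2)[OF scaled_lift_Mp[OF assms], of s] by metis
qed

lemma continuous_map_fst_Mp: "continuous_map Mp_topology (W.Sp_topology TF) fst"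
  unfolding Mp_topology_def by (intro continuous_map_from_subtopology continuous_map_fst)

lemma continuous_section: "continuous_map (W.Sp_topology TF) Mp_topology (\<lambda>g. (g, lift g))"
proof (rule continuous_map_into_Mp)
  show "continuous_map (W.Sp_topology TF) (W.Sp_topology TF) (\<lambda>g. g)" by simp
  show "(g, lift g) \<in> Mp" if "g \<in> topspace (W.Sp_topology TF)" for g
    using scaled_lift_Mp[of g 1] that by (simp add: topspace_Sp_topology)
  show "\<exists>T. openin (W.Sp_topology TF) T \<and> g \<in> T \<and> (\<forall>h\<in>T. lift h s = lift g s)"
    if "g \<in> topspace (W.Sp_topology TF)" for g s
    using lift_locally_constant[of g s] that by (auto simp: topspace_Sp_topology)
qed

text \<open>One nonzero s suffices to read off the scalar: on the open set where
  \<open>lift g s\<close> and \<open>M s\<close> keep their values, their ratio does too.\<close>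

lemma continuous_map_scalar: "continuous_map Mp_topology (discrete_topology {c. c \<noteq> 0}) scalar"
  unfolding continuous_map_def
proof (intro conjI allI impI)
  show "scalar \<in> topspace Mp_topology \<rightarrow> topspace (discrete_topology {c. c \<noteq> 0})"
    using scalar(1) by (auto simp: topspace_Mp_topology)
  fix V
  obtain s :: 's where s: "s \<noteq> 0" using nonzero by blast
  show "openin Mp_topology {x \<in> topspace Mp_topology. scalar x \<in> V}"
  proof (subst openin_subopen, intro ballI)
    fix x assume "x \<in> {x \<in> topspace Mp_topology. scalar x \<in> V}"
    then obtain g0 M0 where x: "x = (g0, M0)" "(g0, M0) \<in> Mp" "scalar (g0, M0) \<in> V"
      by (cases x) (auto simp: topspace_Mp_topology)
    then have g0: "g0 \<in> W.Sp" by (simp add: Mp_iff)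
    obtain T where T: "openin (W.Sp_topology TF) T" "g0 \<in> T" "\<forall>g\<in>T. lift g s = lift g0 s"
      using lift_locally_constant[OF g0, of s] by blast
    let ?U = "Mp \<inter> (T \<times> {M \<in> GL scaleS. M s = M0 s})"
    have "openin (GL_topology scaleS) {M \<in> GL scaleS. M s = M0 s}"
      unfolding GL_topology_def by (rule topology_generated_by_Basis) blast
    then have "openin Mp_topology ?U"
      unfolding Mp_topology_def using T(1)
      by (intro openin_subtopology_Int2) (simp add: openin_prod_Times_iff)
    moreover have "x \<in> ?U" using x T(2) by (auto simp: Mp_iff)
    moreover
    have "scalar (g, M) = scalar (g0, M0)" if "(g, M) \<in> ?U" for g M
    proof (rule scalar_eqI[OF g0 s])
      have gM: "(g, M) \<in> Mp" "g \<in> T" "M s = M0 s" using that by simp_all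
      have "scaleS (scalar (g, M)) (lift g0 s) = M s"
        using scalar(2)[OF gM(1), of s] bspec[OF T(3) gM(2)] by simp
      also have "\<dots> = scaleS (scalar (g0, M0)) (lift g0 s)"
        unfolding gM(3) by (rule scalar(2)[OF x(2)])
      finally show "scaleS (scalar (g, M)) (lift g0 s) = scaleS (scalar (g0, M0)) (lift g0 s)" .
    qed
    then have "?U \<subseteq> {x \<in> topspace Mp_topology. scalar x \<in> V}"
      using x(3) by (force simp: topspace_Mp_topology)
    ultimately show "\<exists>T. openin Mp_topology T \<and> x \<in> T \<and> T \<subseteq> {x \<in> topspace Mp_topology. scalar x \<in> V}"
      by blast
  qed
qed

lemma covering: "covering_with_fibre Mp_topology (W.Sp_topology TF) {c::'r. c \<noteq> 0} fst"
  unfolding covering_with_fibre_def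
proof (intro conjI ballI continuous_map_fst_Mp)
  let ?B = "W.Sp_topology TF" and ?D = "discrete_topology {c::'r. c \<noteq> 0}"
  fix b assume b: "b \<in> topspace ?B"
  \<comment> \<open>The trivialisation is global: at every b the neighbourhood U is the whole
    base.\<close>
  let ?\<phi> = "\<lambda>x. (fst x, scalar x)" and ?\<phi>' = "\<lambda>y. (fst y, \<lambda>s. scaleS (snd y) (lift (fst y) s))"
  have cont: "continuous_map Mp_topology (prod_topology ?B ?D) ?\<phi>"
    by (intro continuous_map_pairedI continuous_map_fst_Mp continuous_map_scalar)
  have cont': "continuous_map (prod_topology ?B ?D) Mp_topology ?\<phi>'"
  proof (rule continuous_map_into_Mp[OF continuous_map_fst])
    fix y assume y: "y \<in> topspace (prod_topology ?B ?D)"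
    then show "(fst y, \<lambda>s. scaleS (snd y) (lift (fst y) s)) \<in> Mp"
      using scaled_lift_Mp by (auto simp: topspace_Sp_topology)
    fix s
    have y1: "fst y \<in> W.Sp" "snd y \<noteq> 0" using y by (auto simp: topspace_Sp_topology)
    obtain T where T: "openin ?B T" "fst y \<in> T" "\<forall>g\<in>T. lift g s = lift (fst y) s"
      using lift_locally_constant[OF y1(1), of s] by blast
    have "\<forall>z\<in>T \<times> {snd y}. scaleS (snd z) (lift (fst z) s) = scaleS (snd y) (lift (fst y) s)"
    proof
      fix z assume "z \<in> T \<times> {snd y}"
      then show "scaleS (snd z) (lift (fst z) s) = scaleS (snd y) (lift (fst y) s)"
        using bspec[OF T(3), of "fst z"] by (cases z) simp
    qed
    moreover have "openin (prod_topology ?B ?D) (T \<times> {snd y})" "y \<in> T \<times> {snd y}"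
      using T(1,2) y1(2) by (simp_all add: openin_prod_Times_iff mem_Times_iff)
    ultimately show "\<exists>T. openin (prod_topology ?B ?D) T \<and> y \<in> T \<and>
        (\<forall>z\<in>T. scaleS (snd z) (lift (fst z) s) = scaleS (snd y) (lift (fst y) s))"
      by (intro exI[of _ "T \<times> {snd y}"] conjI)
  qed
  have "homeomorphic_maps Mp_topology (prod_topology ?B ?D) ?\<phi> ?\<phi>'"
    unfolding homeomorphic_maps_def
  proof (intro conjI cont cont' ballI)
    show "?\<phi>' (?\<phi> x) = x" if "x \<in> topspace Mp_topology" for x
      using that scalar(2) by (cases x) (auto simp: topspace_Mp_topology fun_eq_iff)
    show "?\<phi> (?\<phi>' y) = y" if "y \<in> topspace (prod_topology ?B ?D)" for y
      using that scalar_scaled_lift by (auto simp: topspace_Sp_topology)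
  qed
  then have "homeomorphic_map Mp_topology (prod_topology ?B ?D) ?\<phi>"
    by (rule homeomorphic_maps_imp_map)
  moreover have "{x \<in> topspace Mp_topology. fst x \<in> topspace ?B} = topspace Mp_topology"
    by (auto simp: topspace_Mp_topology topspace_Sp_topology Mp_iff)
  ultimately show "\<exists>U \<phi>. openin ?B U \<and> b \<in> U \<and>
      homeomorphic_map (subtopology Mp_topology {x \<in> topspace Mp_topology. fst x \<in> U})
        (prod_topology (subtopology ?B U) ?D) \<phi> \<and>
      (\<forall>x\<in>topspace Mp_topology. fst x \<in> U \<longrightarrow> fst (\<phi> x) = fst x)"
    using b by (intro exI[of _ "topspace ?B"] exI[of _ ?\<phi>]) simp
qed

end

theorem proposition3p8:
  fixes p :: nat and TF :: "'f::field topology"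
    and scaleW :: "'f \<Rightarrow> 'w::ab_group_add \<Rightarrow> 'w" and Basis :: "'w set"
    and form :: "'w \<Rightarrow> 'w \<Rightarrow> 'f"
    and \<psi> :: "'f \<Rightarrow> 'r::field"
    and scaleS :: "'r \<Rightarrow> 's::ab_group_add \<Rightarrow> 's"
    and \<rho> :: "'w \<times> 'f \<Rightarrow> 's \<Rightarrow> 's"
  assumes "metaplectic_setting p TF scaleW Basis form \<psi> scaleS \<rho>"
  shows "covering_with_fibre
           (heisenberg_representation.Mp_topology scaleW Basis form scaleS TF \<rho>)
           (symplectic_space.Sp_topology scaleW Basis form TF) {c::'r. c \<noteq> 0} fst \<and>
         (\<exists>\<sigma>. continuous_map (symplectic_space.Sp_topology scaleW Basis form TF)
                (heisenberg_representation.Mp_topology scaleW Basis form scaleS TF \<rho>) \<sigma> \<and>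
              (\<forall>g \<in> symplectic_space.Sp scaleW form. fst (\<sigma> g) = g))"
proof -
  interpret M: metaplectic_setting p TF scaleW Basis form \<psi> scaleS \<rho> by (rule assms)
  obtain A D where "dual_lattices TF \<psi> p A D"
    using exists_dual_lattices[OF M.base_field M.char_ne_2 M.\<psi>_smooth M.\<psi>_nontrivial] by blast
  moreover obtain n e f where "M.W.symplectic_family n e f"
    "\<And>w. w = (\<Sum>i<n. scaleW (form w (f i)) (e i) + scaleW (form (e i) w) (f i))"
    using M.W.symplectic_basis by blast
  ultimately interpret polarized_setting p TF scaleW Basis form \<psi> scaleS \<rho> A D n e f
    by (intro polarized_setting.intro assms polarized_setting_axioms.intro)
  show ?thesis
    using covering continuous_section by (intro conjI exI[of _ "\<lambda>g. (g, lift g)"]) auto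
qed

end
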